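(* Let $G$ be a subgroup of $\Gamma=\mathrm{PSL}_2(\mathbb{Z})$. If the widths of all cusps of $X(G)$ are the same, then $N_\Gamma(G)/G=N_{\mathrm{PSL}_2(\mathbb{R})}(G)/G$.
   Context: $N_H(G)$ denotes the normaliser of $G$ in $H$. $\mathbb{H}$ is the hyperbolic upper half-plane, $\mathbb{H}^*=\mathbb{H}\sqcup\mathbb{Q}\sqcup\{\infty\}$, $X(G)=G\backslash\mathbb{H}^*$, and the cusps of $X(G)$ are the elements of $G\backslash(\mathbb{Q}\sqcup\{\infty\})$. Let $\triangle$ be the hyperbolic triangle with vertices $e^{\pi i/3},0,\infty$. For a cusp $x\in X(G)$, the edges of the copies of the triangle $\triangle$ (the images in $X(G)$ of its $\Gamma$-copies) cut a small neighbourhood of $x$ into some number of sectors; this number is called the width of the cusp $x$ and denoted $w_x$. Each copy of $\triangle$ contributes $0$, $1$ or $2$ to $w_x$.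
   Formalization: The formal statement additionally assumes that every cusp has finite width (a finite number of sectors); without this, the trivial subgroup G, all of whose cusps have infinitely many sectors, is a counterexample. *)

theory Defs
  imports
    "HOL-Analysis.Analysis"
    "HOL-Algebra.Group_Action"
    "HOL-Library.Extended_Nat"
begin

definition SL2R :: "(real^2^2) monoid" where
  "SL2R = \<lparr>carrier = {A. det A = 1}, mult = (**), one = mat 1\<rparr>"

definition SL2Z :: "(real^2^2) monoid" where
  "SL2Z = SL2R\<lparr>carrier := {A \<in> carrier SL2R. \<forall>i j. A $ i $ j \<in> \<int>}\<rparr>"

definition PSL2R :: "(real^2^2) set monoid" where
  "PSL2R = SL2R Mod {mat 1, - mat 1}"

text \<open>
  An element of either quotient is a two-element set \<open>{A, -A}\<close>, so that the carrier of
  \<open>PSL2Z\<close> is literally a subset of the carrier of \<open>PSL2R\<close>, with the same multiplication.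
\<close>

definition PSL2Z :: "(real^2^2) set monoid" where
  "PSL2Z = SL2Z Mod {mat 1, - mat 1}"

datatype xcomplex = Fin complex | Infty

fun mat_act :: "real^2^2 \<Rightarrow> xcomplex \<Rightarrow> xcomplex" where
  "mat_act A (Fin z) =
     (if of_real (A $ 2 $ 1) * z + of_real (A $ 2 $ 2) = 0 then Infty
      else Fin (moebius (of_real (A $ 1 $ 1)) (of_real (A $ 1 $ 2))
                        (of_real (A $ 2 $ 1)) (of_real (A $ 2 $ 2)) z))"
| "mat_act A Infty =
     (if A $ 2 $ 1 = 0 then Infty else Fin (of_real (A $ 1 $ 1 / A $ 2 $ 1)))"

text \<open>All representatives of an element of \<open>PSL2R\<close> act in the same way.\<close>

definition psl_act :: "(real^2^2) set \<Rightarrow> xcomplex \<Rightarrow> xcomplex" where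
  "psl_act C p = the_elem ((\<lambda>A. mat_act A p) ` C)"

definition upper_half_plane :: "complex set" where
  "upper_half_plane = {z. Im z > 0}"

definition boundary_cusps :: "xcomplex set" where
  "boundary_cusps = insert Infty (range (\<lambda>q::rat. Fin (of_rat q)))"

definition Hstar :: "xcomplex set" where
  "Hstar = Fin ` upper_half_plane \<union> boundary_cusps"

text \<open>
  Open horoballs: at a finite point the disc of radius \<open>r\<close> tangent to the real axis there.
  In all cases the horoballs at a given point shrink as \<open>r\<close> decreases to \<open>0\<close>.
\<close>

fun horoball :: "real \<Rightarrow> xcomplex \<Rightarrow> complex set" where
  "horoball r (Fin s) = ball (s + \<i> * of_real r) r"
| "horoball r Infty = {z. Im z > 1 / r}"

definition cusp_nhd :: "real \<Rightarrow> xcomplex \<Rightarrow> xcomplex set" where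
  "cusp_nhd r s = insert s (Fin ` horoball r s)"

text \<open>
  The usual topology of the extended half-plane: Euclidean on the half-plane, with the
  sets \<open>cusp_nhd r s\<close> as a neighbourhood basis at a cusp \<open>s\<close>.
\<close>

definition Hstar_open :: "xcomplex set \<Rightarrow> bool" where
  "Hstar_open U \<longleftrightarrow>
     U \<subseteq> Hstar \<and> open {z \<in> upper_half_plane. Fin z \<in> U} \<and>
     (\<forall>s \<in> U \<inter> boundary_cusps. \<exists>r>0. cusp_nhd r s \<subseteq> U)"

definition Hstar_topology :: "xcomplex topology" where
  "Hstar_topology = topology Hstar_open"

lemma horoball_mono:
  assumes "0 < r" "r \<le> r'"
  shows "horoball r s \<subseteq> horoball r' s"
proof (cases s)
  case (Fin z)
  have "dist (z + \<i> * of_real r) (z + \<i> * of_real r') = r' - r"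
  proof -
    have "z + \<i> * of_real r - (z + \<i> * of_real r') = \<i> * of_real (r - r')"
      by (simp add: algebra_simps)
    then show ?thesis
      using assms by (simp only: dist_norm norm_mult norm_of_real) simp
  qed
  then show ?thesis
    using Fin by (simp add: subset_ball ball_subset_ball_iff)
next
  case Infty
  have "1 / r' \<le> 1 / r"
    using assms by (simp add: frac_le)
  then show ?thesis
    using Infty by auto
qed

lemma istopology_Hstar_open: "istopology Hstar_open"
  unfolding istopology_def
proof (intro conjI allI impI)
  fix S T assume S: "Hstar_open S" and T: "Hstar_open T"
  have "{z \<in> upper_half_plane. Fin z \<in> S \<inter> T} =
        {z \<in> upper_half_plane. Fin z \<in> S} \<inter> {z \<in> upper_half_plane. Fin z \<in> T}"
    by auto
  then have op: "open {z \<in> upper_half_plane. Fin z \<in> S \<inter> T}"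
    using S T by (auto simp: Hstar_open_def)
  have "\<exists>r>0. cusp_nhd r s \<subseteq> S \<inter> T" if s: "s \<in> S \<inter> T \<inter> boundary_cusps" for s
  proof -
    obtain r1 r2 where r: "r1 > 0" "cusp_nhd r1 s \<subseteq> S" "r2 > 0" "cusp_nhd r2 s \<subseteq> T"
      using S T s unfolding Hstar_open_def by blast
    have "cusp_nhd (min r1 r2) s \<subseteq> cusp_nhd r1 s" "cusp_nhd (min r1 r2) s \<subseteq> cusp_nhd r2 s"
      using horoball_mono[of "min r1 r2" r1 s] horoball_mono[of "min r1 r2" r2 s] r(1,3)
      unfolding cusp_nhd_def by auto
    then show ?thesis
      using r by (intro exI[of _ "min r1 r2"]) auto
  qed
  then show "Hstar_open (S \<inter> T)"
    using op S unfolding Hstar_open_def by blast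
next
  fix K assume K: "\<forall>S\<in>K. Hstar_open S"
  have "{z \<in> upper_half_plane. Fin z \<in> \<Union>K} = (\<Union>S\<in>K. {z \<in> upper_half_plane. Fin z \<in> S})"
    by auto
  moreover have "open (\<Union>S\<in>K. {z \<in> upper_half_plane. Fin z \<in> S})"
    using K by (intro open_UN) (simp add: Hstar_open_def)
  moreover have "\<exists>r>0. cusp_nhd r s \<subseteq> \<Union>K" if "s \<in> \<Union>K \<inter> boundary_cusps" for s
    using that K unfolding Hstar_open_def by (meson IntD1 IntD2 IntI UnionE Union_upper subset_trans)
  ultimately show "Hstar_open (\<Union>K)"
    using K unfolding Hstar_open_def by (metis (no_types, lifting) Union_least)
qed

lemma openin_Hstar_topology: "openin Hstar_topology U \<longleftrightarrow> Hstar_open U"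
  unfolding Hstar_topology_def using istopology_Hstar_open by (simp add: topology_inverse')

definition G_orbit :: "(real^2^2) set set \<Rightarrow> xcomplex \<Rightarrow> xcomplex set" where
  "G_orbit G p = orbit (PSL2R\<lparr>carrier := G\<rparr>) psl_act p"

definition modular_curve :: "(real^2^2) set set \<Rightarrow> xcomplex set set" where
  "modular_curve G = orbits (PSL2R\<lparr>carrier := G\<rparr>) Hstar psl_act"

definition modular_curve_open :: "(real^2^2) set set \<Rightarrow> xcomplex set set \<Rightarrow> bool" where
  "modular_curve_open G V \<longleftrightarrow>
     V \<subseteq> modular_curve G \<and> openin Hstar_topology {p \<in> Hstar. G_orbit G p \<in> V}"

text \<open>The quotient topology.\<close>

definition modular_curve_topology :: "(real^2^2) set set \<Rightarrow> xcomplex set topology" where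
  "modular_curve_topology G = topology (modular_curve_open G)"

lemma istopology_modular_curve_open: "istopology (modular_curve_open G)"
  unfolding istopology_def
proof (intro conjI allI impI)
  fix S T assume S: "modular_curve_open G S" and T: "modular_curve_open G T"
  have "{p \<in> Hstar. G_orbit G p \<in> S \<inter> T} =
        {p \<in> Hstar. G_orbit G p \<in> S} \<inter> {p \<in> Hstar. G_orbit G p \<in> T}"
    by auto
  then show "modular_curve_open G (S \<inter> T)"
    using S T unfolding modular_curve_open_def by auto
next
  fix K assume K: "\<forall>S\<in>K. modular_curve_open G S"
  have "{p \<in> Hstar. G_orbit G p \<in> \<Union>K} = (\<Union>S\<in>K. {p \<in> Hstar. G_orbit G p \<in> S})"
    by auto
  moreover have "openin Hstar_topology (\<Union>S\<in>K. {p \<in> Hstar. G_orbit G p \<in> S})"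
    using K unfolding modular_curve_open_def by (intro openin_Union) auto
  ultimately show "modular_curve_open G (\<Union>K)"
    using K unfolding modular_curve_open_def by (metis (no_types, lifting) Union_least)
qed

lemma openin_modular_curve_topology:
  "openin (modular_curve_topology G) V \<longleftrightarrow> modular_curve_open G V"
  unfolding modular_curve_topology_def
  using istopology_modular_curve_open by (simp add: topology_inverse')

definition cusps :: "(real^2^2) set set \<Rightarrow> xcomplex set set" where
  "cusps G = orbits (PSL2R\<lparr>carrier := G\<rparr>) boundary_cusps psl_act"

text \<open>
  The three sides, including their end points, of the hyperbolic triangle with vertices
  \<open>cis (pi / 3)\<close>, \<open>0\<close> and \<open>\<infinity>\<close>. The geodesic through \<open>0\<close> and \<open>cis (pi / 3)\<close> is the
  half-circle with centre \<open>1\<close> and radius \<open>1\<close>; the side is its part to the left of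
  \<open>cis (pi / 3)\<close>.
\<close>

definition triangle_edges :: "xcomplex set set" where
  "triangle_edges =
     {{Fin 0, Infty} \<union> Fin ` {z. Re z = 0 \<and> Im z > 0},
      {Infty} \<union> Fin ` {z. Re z = Re (cis (pi / 3)) \<and> Im z \<ge> Im (cis (pi / 3))},
      {Fin 0} \<union> Fin ` {z. cmod (z - 1) = 1 \<and> Im z > 0 \<and> Re z \<le> Re (cis (pi / 3))}}"

text \<open>The union of the images in the modular curve of the sides of all the copies of the
  triangle under the modular group.\<close>

definition edge_locus :: "(real^2^2) set set \<Rightarrow> xcomplex set set" where
  "edge_locus G =
     (\<Union>\<gamma> \<in> carrier PSL2Z. \<Union>e \<in> triangle_edges. (\<lambda>p. G_orbit G (psl_act \<gamma> p)) ` e)"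

definition sectors :: "(real^2^2) set set \<Rightarrow> xcomplex \<Rightarrow> real \<Rightarrow> xcomplex set set set" where
  "sectors G s r =
     connected_components_of
       (subtopology (modular_curve_topology G) (G_orbit G ` cusp_nhd r s - edge_locus G))"

definition ecard :: "'a set \<Rightarrow> enat" where
  "ecard S = (if finite S then enat (card S) else \<infinity>)"

text \<open>
  ``Small neighbourhood'' means the image of a horoball of sufficiently small size \<open>r\<close>
  at a point \<open>s\<close> of the orbit \<open>x\<close>. The horoballs at different points of the orbit are not
  matched in size, but the number of sectors is the same for all of them once \<open>r\<close> is small.
\<close>

definition cusp_width :: "(real^2^2) set set \<Rightarrow> xcomplex set \<Rightarrow> enat" where
  "cusp_width G x =
     (THE n. \<forall>s\<in>x. \<forall>\<^sub>F r in at_right 0. ecard (sectors G s r) = n)"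

end

theory Submission
  imports Defs
begin

text \<open>
  A cusp of \<open>G\<close> is represented by \<open>\<gamma> \<infinity>\<close> with \<open>\<gamma> \<in> SL2Z\<close>. High up, the copies of the edges are the
  lines \<open>2 Re z \<in> \<int>\<close>, and two points of a small horoball are identified only by the parabolic
  elements \<open>\<gamma> T\<^sup>n \<gamma>\<^sup>-\<^sup>1\<close> of \<open>G\<close>; if these are the ones with \<open>w dvd n\<close>, then the sectors are the half-strips
  \<open>k/2 < Re z < (k + 1)/2\<close> modulo \<open>2w\<close>, so that the width is \<open>2w\<close> (or \<open>\<infinity>\<close> if \<open>w = 0\<close>). Under the
  hypotheses \<open>w > 0\<close> is the same for all \<open>\<gamma>\<close>.

  Let \<open>h \<in> SL2R\<close> normalise \<open>G\<close> and \<open>\<gamma>0 \<in> SL2Z\<close>. As \<open>h\<close> maps cusps to cusps, \<open>h \<gamma>0 \<infinity> = \<gamma> \<infinity>\<close> for some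
  \<open>\<gamma> \<in> SL2Z\<close>, and the first column of \<open>h \<gamma>0\<close> is \<open>t\<close> times that of \<open>\<gamma>\<close>. Conjugation by \<open>h\<close> turns
  \<open>\<gamma>0 T\<^sup>w \<gamma>0\<^sup>-\<^sup>1\<close> into \<open>\<gamma> T\<^sup>n \<gamma>\<^sup>-\<^sup>1\<close> with \<open>n = t\<^sup>2 w\<close>, so \<open>t\<^sup>2\<close> is an integer, and conjugation by the inverse of
  \<open>h\<close> shows the same for \<open>1 / t\<^sup>2\<close>. Hence \<open>t = \<plusminus>1\<close> and the first column of \<open>h \<gamma>0\<close> is integral; taking
  \<open>\<gamma>0\<close> to be the identity and the rotation \<open>z \<mapsto> -1/z\<close> shows that \<open>h\<close> is integral.
\<close>

section \<open>Matrices modulo sign\<close>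

definition mat22 :: "real \<Rightarrow> real \<Rightarrow> real \<Rightarrow> real \<Rightarrow> real^2^2" where
  "mat22 a b c d = vector [vector [a, b], vector [c, d]]"

lemma mat22_nth [simp]:
  "mat22 a b c d $ 1 $ 1 = a" "mat22 a b c d $ 1 $ 2 = b"
  "mat22 a b c d $ 2 $ 1 = c" "mat22 a b c d $ 2 $ 2 = d"
  by (simp_all add: mat22_def)

lemma mat22_eq_iff:
  "A = B \<longleftrightarrow> A$1$1 = B$1$1 \<and> A$1$2 = B$1$2 \<and> A$2$1 = B$2$1 \<and> A$2$2 = (B$2$2 :: real)"
  for A B :: "real^2^2"
  by (auto simp: vec_eq_iff forall_2)

lemma matmul_nth:
  "(A ** B) $ i $ j = A$i$1 * B$1$j + A$i$2 * B$2$j" for A B :: "real^2^2"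
  by (simp add: matrix_matrix_mult_def sum_2)

lemma mat_1_nth [simp]:
  "(mat 1 :: real^2^2) $ 1 $ 1 = 1" "(mat 1 :: real^2^2) $ 1 $ 2 = 0"
  "(mat 1 :: real^2^2) $ 2 $ 1 = 0" "(mat 1 :: real^2^2) $ 2 $ 2 = 1"
  by (simp_all add: mat_def)

lemma matmul_minus [simp]:
  "(- A) ** B = - (A ** B)" "A ** (- B) = - (A ** B)" for A B :: "real^2^2"
  by (simp_all add: mat22_eq_iff matmul_nth)

text \<open>The adjugate: it is the inverse when the determinant is 1, and being linear in the
  entries it keeps integrality and lets identities be checked entry by entry.\<close>

definition adj :: "real^2^2 \<Rightarrow> real^2^2" where
  "adj A = mat22 (A$2$2) (- A$1$2) (- A$2$1) (A$1$1)"

lemma adj_nth [simp]: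
  "adj A $ 1 $ 1 = A$2$2" "adj A $ 1 $ 2 = - A$1$2"
  "adj A $ 2 $ 1 = - A$2$1" "adj A $ 2 $ 2 = A$1$1"
  by (simp_all add: adj_def)

lemma det_minus [simp]: "det (- A) = det A" for A :: "real^2^2"
  by (simp add: det_2)

lemma det_adj [simp]: "det (adj A) = det A"
  by (simp add: det_2)

lemma adj_adj [simp]: "adj (adj A) = A"
  by (simp add: mat22_eq_iff)

lemma adj_mul: "adj (A ** B) = adj B ** adj A"
  by (simp add: mat22_eq_iff matmul_nth algebra_simps)

lemma mul_adj: "det A = 1 \<Longrightarrow> A ** adj A = mat 1"
  by (simp add: mat22_eq_iff matmul_nth det_2 algebra_simps)

lemma adj_mul_self: "det A = 1 \<Longrightarrow> adj A ** A = mat 1"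
  by (simp add: mat22_eq_iff matmul_nth det_2 algebra_simps)

lemma mul_adj_cancel [simp]:
  assumes "det A = 1"
  shows "A ** (adj A ** B) = B" "adj A ** (A ** B) = B"
  by (simp_all add: assms matrix_mul_assoc mul_adj adj_mul_self)

definition SLZ :: "(real^2^2) set" where
  "SLZ = {A. det A = 1 \<and> (\<forall>i j. A $ i $ j \<in> \<int>)}"

lemma SLZ_det: "A \<in> SLZ \<Longrightarrow> det A = 1"
  by (simp add: SLZ_def)

lemma SLZ_Ints: "A \<in> SLZ \<Longrightarrow> A $ i $ j \<in> \<int>"
  by (simp add: SLZ_def)

lemma SLZ_I:
  "det A = 1 \<Longrightarrow> A$1$1 \<in> \<int> \<Longrightarrow> A$1$2 \<in> \<int> \<Longrightarrow> A$2$1 \<in> \<int> \<Longrightarrow> A$2$2 \<in> \<int> \<Longrightarrow> A \<in> SLZ"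
  by (simp add: SLZ_def forall_2)

lemma SLZ_mult: "A \<in> SLZ \<Longrightarrow> B \<in> SLZ \<Longrightarrow> A ** B \<in> SLZ"
  by (rule SLZ_I) (simp_all add: SLZ_det det_mul matmul_nth SLZ_Ints)

lemma SLZ_adj: "A \<in> SLZ \<Longrightarrow> adj A \<in> SLZ"
  by (rule SLZ_I) (simp_all add: SLZ_det SLZ_Ints)

lemma SLZ_minus: "A \<in> SLZ \<Longrightarrow> - A \<in> SLZ"
  by (rule SLZ_I) (simp_all add: SLZ_det SLZ_Ints)

lemma SLZ_one: "mat 1 \<in> SLZ"
  by (rule SLZ_I) simp_all

section \<open>The quotient groups as classes of matrices up to sign\<close>

definition pclass :: "real^2^2 \<Rightarrow> (real^2^2) set" where
  "pclass A = {A, - A}"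

lemma pclass_eq_iff: "pclass A = pclass B \<longleftrightarrow> B = A \<or> B = - A"
  by (auto simp: pclass_def doubleton_eq_iff)

lemma carrier_PSL2R: "carrier PSL2R = pclass ` {A. det A = 1}"
  by (auto simp: PSL2R_def SL2R_def FactGroup_def RCOSETS_def r_coset_def pclass_def image_def)

lemma carrier_PSL2Z: "carrier PSL2Z = pclass ` SLZ"
  by (auto simp: PSL2Z_def SL2Z_def SL2R_def FactGroup_def RCOSETS_def r_coset_def pclass_def
      image_def SLZ_def)

lemma mult_PSL2R: "pclass A \<otimes>\<^bsub>PSL2R\<^esub> pclass B = pclass (A ** B)"
  by (auto simp: PSL2R_def SL2R_def FactGroup_def set_mult_def pclass_def)

lemma one_PSL2R: "\<one>\<^bsub>PSL2R\<^esub> = pclass (mat 1)"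
  by (simp add: PSL2R_def FactGroup_def pclass_def)

text \<open>The product of cosets and the unit coset make no reference to the carrier of the matrix
  group, so restricting the matrices only restricts the carrier of the quotient.\<close>

lemma PSL2Z_eq: "PSL2Z = PSL2R\<lparr>carrier := carrier PSL2Z\<rparr>"
  by (auto simp: PSL2Z_def PSL2R_def SL2Z_def SL2R_def FactGroup_def set_mult_def fun_eq_iff)

lemma mult_PSL2Z: "pclass A \<otimes>\<^bsub>PSL2Z\<^esub> pclass B = pclass (A ** B)"
  by (subst PSL2Z_eq) (simp add: mult_PSL2R)

lemma one_PSL2Z: "\<one>\<^bsub>PSL2Z\<^esub> = pclass (mat 1)"
  by (subst PSL2Z_eq) (simp add: one_PSL2R)

lemma group_PSL2R: "group PSL2R"
proof (rule groupI)
  fix x assume "x \<in> carrier PSL2R"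
  then obtain A where A: "x = pclass A" "det A = 1"
    by (auto simp: carrier_PSL2R)
  then have "pclass (adj A) \<in> carrier PSL2R" "pclass (adj A) \<otimes>\<^bsub>PSL2R\<^esub> x = \<one>\<^bsub>PSL2R\<^esub>"
    by (simp_all add: carrier_PSL2R mult_PSL2R one_PSL2R adj_mul_self)
  then show "\<exists>y\<in>carrier PSL2R. y \<otimes>\<^bsub>PSL2R\<^esub> x = \<one>\<^bsub>PSL2R\<^esub>"
    by blast
qed (auto simp: carrier_PSL2R mult_PSL2R one_PSL2R det_mul matrix_mul_assoc)

lemma group_PSL2Z: "group PSL2Z"
proof (rule groupI)
  fix x assume "x \<in> carrier PSL2Z"
  then obtain A where A: "x = pclass A" "A \<in> SLZ"
    by (auto simp: carrier_PSL2Z)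
  then have "pclass (adj A) \<in> carrier PSL2Z" "pclass (adj A) \<otimes>\<^bsub>PSL2Z\<^esub> x = \<one>\<^bsub>PSL2Z\<^esub>"
    by (simp_all add: carrier_PSL2Z mult_PSL2Z one_PSL2Z adj_mul_self SLZ_adj SLZ_det)
  then show "\<exists>y\<in>carrier PSL2Z. y \<otimes>\<^bsub>PSL2Z\<^esub> x = \<one>\<^bsub>PSL2Z\<^esub>"
    by blast
qed (auto simp: carrier_PSL2Z mult_PSL2Z one_PSL2Z SLZ_mult SLZ_one matrix_mul_assoc)

lemma inv_PSL2R: "det A = 1 \<Longrightarrow> inv\<^bsub>PSL2R\<^esub> (pclass A) = pclass (adj A)"
  by (rule group.inv_equality[OF group_PSL2R])
     (simp_all add: carrier_PSL2R mult_PSL2R one_PSL2R adj_mul_self)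

lemma inv_PSL2Z: "A \<in> SLZ \<Longrightarrow> inv\<^bsub>PSL2Z\<^esub> (pclass A) = pclass (adj A)"
  by (rule group.inv_equality[OF group_PSL2Z])
     (simp_all add: carrier_PSL2Z mult_PSL2Z one_PSL2Z adj_mul_self SLZ_adj SLZ_det)

section \<open>Integral columns and translations\<close>

lemma ex_SLZ_column:
  assumes "coprime p (q :: int)"
  obtains A where "A \<in> SLZ" "A$1$1 = of_int p" "A$2$1 = of_int q"
proof -
  obtain u v where uv: "u * p + v * q = 1"
    using assms bezout_int[of p q] by auto
  \<comment> \<open>The Bezout coefficients fill the second column, so that the determinant is u p +
    v q.\<close>
  have "mat22 (of_int p) (of_int (- v)) (of_int q) (of_int u) \<in> SLZ"
  proof (rule SLZ_I)
    have "real_of_int (u * p + v * q) = 1"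
      by (simp only: uv of_int_1)
    then show "det (mat22 (of_int p) (of_int (- v)) (of_int q) (of_int u)) = 1"
      by (simp add: det_2 algebra_simps)
  qed simp_all
  then show thesis
    using that by fastforce
qed

definition transl :: "real \<Rightarrow> real^2^2" where
  "transl x = mat22 1 x 0 1"

lemma transl_nth [simp]:
  "transl x $ 1 $ 1 = 1" "transl x $ 1 $ 2 = x" "transl x $ 2 $ 1 = 0" "transl x $ 2 $ 2 = 1"
  by (simp_all add: transl_def)

lemma transl_add: "transl x ** transl y = transl (x + y)"
  by (simp add: mat22_eq_iff matmul_nth)

lemma transl_0 [simp]: "transl 0 = mat 1"
  by (simp add: mat22_eq_iff)

lemma adj_transl [simp]: "adj (transl x) = transl (- x)"
  by (simp add: mat22_eq_iff)

lemma det_transl [simp]: "det (transl x) = 1"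
  by (simp add: det_2)

lemma transl_SLZ_iff [simp]: "transl x \<in> SLZ \<longleftrightarrow> x \<in> \<int>"
  using SLZ_Ints[of "transl x" 1 2] by (auto intro!: SLZ_I)

text \<open>The diagonal entries are integers with product 1, so both are 1 or both are -1. This
  describes the stabiliser of \<infinity> in \<open>SLZ\<close>.\<close>

lemma SLZ_upper_triangular:
  assumes "A \<in> SLZ" "A$2$1 = 0"
  obtains n :: int where "A = transl (of_int n) \<or> A = - transl (of_int n)"
proof -
  obtain a b d :: int where abd: "A$1$1 = of_int a" "A$1$2 = of_int b" "A$2$2 = of_int d"
    using SLZ_Ints[OF assms(1)] by (metis Ints_cases)
  have "real_of_int (a * d) = 1"
    using SLZ_det[OF assms(1)] assms(2) abd by (simp add: det_2)
  then have "a * d = 1"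
    by linarith
  then have "a = 1 \<and> d = 1 \<or> a = - 1 \<and> d = - 1"
    by (auto simp: zmult_eq_1_iff)
  then show thesis
    using that[of b] that[of "- b"] assms(2) abd by (auto simp: mat22_eq_iff)
qed

text \<open>The fraction a / c in lowest terms gives the direction of the column. The column in
  question is the first one of \<open>h ** \<gamma>0\<close>, and t is the factor to be shown to be
  1 or -1.\<close>

lemma real_pair_multiple_of_coprime:
  fixes a c :: real
  assumes "c = 0 \<or> a / c \<in> \<rat>"
  obtains t :: real and p q :: int where "coprime p q" "a = t * p" "c = t * q"
proof (cases "c = 0")
  case True
  then show thesis
    using that[of 1 0 a] by simp
next
  case False
  then obtain r where r: "a / c = of_rat r"
    using assms by (auto elim: Rats_cases)
  obtain p q where pq: "quotient_of r = (p, q)"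
    by fastforce
  have "q > 0" "coprime p q" "r = of_int p / of_int q"
    using quotient_of_denom_pos[OF pq] quotient_of_coprime[OF pq] quotient_of_div[OF pq] by auto
  moreover have "a = c / q * p"
    using False \<open>q > 0\<close> r \<open>r = of_int p / of_int q\<close> by (simp add: of_rat_divide field_simps)
  ultimately show thesis
    using that[of p q "c / q"] by simp
qed

section \<open>The normaliser\<close>

locale modular_subgroup =
  fixes G :: "(real^2^2) set set"
  assumes subgroup_G: "subgroup G PSL2Z"
begin

text \<open>The full preimage of \<open>G\<close> among the integral matrices. It contains -A along
  with A, so membership of a class in \<open>G\<close> can be tested on either
  representative.\<close>

definition K :: "(real^2^2) set" where
  "K = {A \<in> SLZ. pclass A \<in> G}"

lemma K_SLZ: "A \<in> K \<Longrightarrow> A \<in> SLZ"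
  by (simp add: K_def)

lemma K_det: "A \<in> K \<Longrightarrow> det A = 1"
  by (simp add: K_SLZ SLZ_det)

lemma in_G_iff: "X \<in> G \<longleftrightarrow> (\<exists>A\<in>K. X = pclass A)"
  using subgroup.subset[OF subgroup_G] by (auto simp: K_def carrier_PSL2Z)

lemma K_one: "mat 1 \<in> K"
  using subgroup.one_closed[OF subgroup_G] by (simp add: K_def one_PSL2Z SLZ_one)

lemma K_mult: "A \<in> K \<Longrightarrow> B \<in> K \<Longrightarrow> A ** B \<in> K"
  using subgroup.m_closed[OF subgroup_G, of "pclass A" "pclass B"]
  by (simp add: K_def mult_PSL2Z SLZ_mult)

lemma K_adj: "A \<in> K \<Longrightarrow> adj A \<in> K"
  using subgroup.m_inv_closed[OF subgroup_G, of "pclass A"]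
  by (simp add: K_def inv_PSL2Z SLZ_adj)

lemma K_minus: "A \<in> K \<Longrightarrow> - A \<in> K"
  by (simp add: K_def SLZ_minus) (simp add: pclass_def insert_commute)

lemma pclass_in_G_iff: "pclass A \<in> G \<longleftrightarrow> A \<in> K"
  using K_minus by (fastforce simp: in_G_iff pclass_eq_iff)

lemma G_eq: "G = pclass ` K"
  by (auto simp: in_G_iff image_iff)

lemma UN_G: "(\<Union>x\<in>G. f x) = (\<Union>A\<in>K. f (pclass A))"
  by (rule arg_cong[OF G_eq, of "\<lambda>X. \<Union>x\<in>X. f x", THEN trans]) simp

text \<open>The preimage of the normaliser in SL2R. It asks for an equality of sets, as
  \<open>normalizer\<close> is the stabiliser of \<open>G\<close> under conjugation.\<close>

definition Nor :: "(real^2^2) set" where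
  "Nor = {h. det h = 1 \<and> (\<lambda>A. h ** A ** adj h) ` K = K}"

text \<open>The passage to classes loses nothing because \<open>K\<close> is closed under sign
  change: a sign in front of the conjugate of A can be moved to A.\<close>

lemma conj_pclass_eq_iff:
  "(\<lambda>A. pclass (h ** A ** adj h)) ` K = G \<longleftrightarrow> (\<lambda>A. h ** A ** adj h) ` K = K"
proof
  assume *: "(\<lambda>A. pclass (h ** A ** adj h)) ` K = G"
  show "(\<lambda>A. h ** A ** adj h) ` K = K"
  proof (intro equalityI subsetI)
    fix B assume "B \<in> K"
    then have "pclass B \<in> (\<lambda>A. pclass (h ** A ** adj h)) ` K"
      using * by (simp add: pclass_in_G_iff)
    then obtain A where "A \<in> K" "pclass B = pclass (h ** A ** adj h)"
      by blast
    then have "B = h ** A ** adj h \<or> B = h ** (- A) ** adj h"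
      by (auto simp: pclass_eq_iff)
    then show "B \<in> (\<lambda>A. h ** A ** adj h) ` K"
      using \<open>A \<in> K\<close> K_minus by blast
  qed (use * in \<open>auto simp flip: pclass_in_G_iff\<close>)
next
  assume "(\<lambda>A. h ** A ** adj h) ` K = K"
  then have "pclass ` ((\<lambda>A. h ** A ** adj h) ` K) = pclass ` K"
    by simp
  then show "(\<lambda>A. pclass (h ** A ** adj h)) ` K = G"
    by (auto simp: image_image in_G_iff set_eq_iff image_iff)
qed

lemma normalizer_PSL2R: "normalizer PSL2R G = pclass ` Nor"
proof -
  have "G \<subseteq> carrier PSL2R"
    by (auto simp: in_G_iff carrier_PSL2R K_det)
  moreover have "pclass h <#\<^bsub>PSL2R\<^esub> G #>\<^bsub>PSL2R\<^esub> inv\<^bsub>PSL2R\<^esub> pclass h = (\<lambda>A. pclass (h ** A ** adj h)) ` K"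
    if "det h = 1" for h
    by (auto simp: UN_G l_coset_def r_coset_def inv_PSL2R[OF that] mult_PSL2R)
  ultimately show ?thesis
    by (auto simp: normalizer_def stabilizer_def carrier_PSL2R Nor_def simp flip: conj_pclass_eq_iff)
qed

lemma normalizer_PSL2Z: "normalizer PSL2Z G = pclass ` (Nor \<inter> SLZ)"
proof -
  have "G \<subseteq> carrier PSL2Z"
    using subgroup.subset[OF subgroup_G] .
  moreover have "pclass h <#\<^bsub>PSL2Z\<^esub> G #>\<^bsub>PSL2Z\<^esub> inv\<^bsub>PSL2Z\<^esub> pclass h = (\<lambda>A. pclass (h ** A ** adj h)) ` K"
    if "h \<in> SLZ" for h
    by (auto simp: UN_G l_coset_def r_coset_def inv_PSL2Z[OF that] mult_PSL2Z)
  ultimately show ?thesis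
    by (auto simp: normalizer_def stabilizer_def carrier_PSL2Z Nor_def SLZ_det
        simp flip: conj_pclass_eq_iff)
qed

text \<open>Conjugation by h maps \<open>K\<close> onto itself, and the element of \<open>K\<close>
  that it sends to A is the conjugate of A by the inverse of h.\<close>

lemma Nor_adj_conj:
  assumes "h \<in> Nor" "A \<in> K"
  shows "adj h ** A ** h \<in> K"
proof -
  have h: "det h = 1" and "A \<in> (\<lambda>A. h ** A ** adj h) ` K"
    using assms by (auto simp: Nor_def)
  then obtain B where "B \<in> K" "A = h ** B ** adj h"
    by blast
  moreover from this have "adj h ** A ** h = B"
    by (simp add: h adj_mul_self flip: matrix_mul_assoc)
  ultimately show ?thesis
    by simp
qed

lemma Nor_column_integral:
  fixes w :: int
  assumes h: "h \<in> Nor" and w: "w > 0"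
    and width: "\<And>\<gamma> n. \<gamma> \<in> SLZ \<Longrightarrow> \<gamma> ** transl (of_int n) ** adj \<gamma> \<in> K \<longleftrightarrow> w dvd n"
    and \<gamma>0: "\<gamma>0 \<in> SLZ"
  shows "(h ** \<gamma>0) $ 1 $ 1 \<in> \<int>" "(h ** \<gamma>0) $ 2 $ 1 \<in> \<int>"
proof -
  define g where "g = h ** \<gamma>0"
  have dh: "det h = 1"
    using h by (simp add: Nor_def)
  have d0: "det \<gamma>0 = 1"
    using \<gamma>0 by (rule SLZ_det)
  have dg: "det g = 1"
    by (simp add: g_def det_mul dh d0)
  define B where "B = g ** transl w ** adj g"
  have "\<gamma>0 ** transl w ** adj \<gamma>0 \<in> K"
    using width[OF \<gamma>0] by simp
  then have "h ** (\<gamma>0 ** transl w ** adj \<gamma>0) ** adj h \<in> K"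
    using h by (auto simp: Nor_def)
  then have B: "B \<in> K"
    by (simp add: B_def g_def adj_mul matrix_mul_assoc)
  \<comment> \<open>Up to sign, the factor w and the summand 1, the lower row of B consists of g21^2
    and g11 g21; their quotient is the point g \<infinity>, which is therefore rational.\<close>
  have "B $ 2 $ 1 = - (w * (g$2$1)^2)" "B $ 2 $ 2 = 1 + w * g$1$1 * g$2$1"
    using dg by (simp_all add: B_def matmul_nth det_2 power2_eq_square algebra_simps)
  moreover have "B $ 2 $ 1 \<in> \<int>" "B $ 2 $ 2 \<in> \<int>"
    using B K_SLZ SLZ_Ints by blast+
  ultimately have "w * (g$2$1)^2 \<in> \<int>" "w * g$1$1 * g$2$1 \<in> \<int>"
    by (metis Ints_minus minus_minus, metis Ints_1 Ints_diff add_diff_cancel_left')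
  then have "(w * g$1$1 * g$2$1) / (w * (g$2$1)^2) \<in> \<rat>"
    using Ints_subset_Rats Rats_divide by blast
  then have "g$2$1 = 0 \<or> g$1$1 / g$2$1 \<in> \<rat>"
    using w by (cases "g$2$1 = 0") (simp_all add: power2_eq_square)
  then obtain t :: real and p q :: int
    where pq: "coprime p q" and gp: "g$1$1 = t * p" and gq: "g$2$1 = t * q"
    by (rule real_pair_multiple_of_coprime)
  obtain \<gamma> where \<gamma>: "\<gamma> \<in> SLZ" "\<gamma>$1$1 = p" "\<gamma>$2$1 = q"
    using ex_SLZ_column[OF pq] by blast
  have d1: "det \<gamma> = 1"
    using \<gamma>(1) by (rule SLZ_det)
  have tn0: "t \<noteq> 0"
    using dg gp gq by (auto simp: det_2)
  \<comment> \<open>As \<gamma> and g have proportional first columns, g' is upper triangular with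
    diagonal t, 1 / t; conjugation by it multiplies translation lengths by t^2.\<close>
  define g' where "g' = adj \<gamma> ** g"
  have dg': "det g' = 1"
    by (simp add: g'_def det_mul d1 dg)
  have "g'$1$1 = t * det \<gamma>"
    by (simp add: g'_def matmul_nth gp gq det_2 \<gamma> algebra_simps)
  then have g'11: "g'$1$1 = t"
    by (simp add: d1)
  have g'21: "g'$2$1 = 0"
    by (simp add: g'_def matmul_nth gp gq \<gamma>)
  have g'22: "g'$2$2 = 1 / t"
    using dg' g'11 g'21 tn0 by (simp add: det_2 field_simps)
  have geq: "g = \<gamma> ** g'"
    by (simp add: g'_def d1)
  have conj_up: "g' ** transl w ** adj g' = transl (t^2 * w)"
    using tn0 by (simp add: mat22_eq_iff matmul_nth g'11 g'21 g'22 power2_eq_square field_simps)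
  have conj_down: "adj g' ** transl w ** g' = transl (w / t^2)"
    using tn0 by (simp add: mat22_eq_iff matmul_nth g'11 g'21 g'22 power2_eq_square field_simps)
  have B_eq: "B = \<gamma> ** transl (t^2 * w) ** adj \<gamma>"
    unfolding conj_up[symmetric] unfolding B_def geq adj_mul matrix_mul_assoc ..
  \<comment> \<open>Integrality of B, moved to \<infinity> by \<gamma>, makes t^2 w an integer n;
    then \<open>width\<close> at the cusp \<gamma> \<infinity> gives w dvd n, so t^2 is an
    integer.\<close>
  have "adj \<gamma> ** B ** \<gamma> \<in> SLZ"
    by (simp add: SLZ_mult SLZ_adj K_SLZ B \<gamma>)
  moreover have "adj \<gamma> ** B ** \<gamma> = transl (t^2 * w)"
    by (simp add: B_eq d1 adj_mul_self flip: matrix_mul_assoc)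
  ultimately obtain n where n: "t^2 * w = of_int n"
    by (auto elim: Ints_cases)
  with B B_eq width[OF \<gamma>(1), of n] obtain m where "n = w * m"
    by auto
  with n w have m: "t^2 = of_int m"
    by simp
  \<comment> \<open>The same argument in the opposite direction, with the inverse of h leading from
    the cusp \<gamma> \<infinity> back to \<gamma>0 \<infinity>, makes 1 / t^2 an integer.\<close>
  have "\<gamma> ** transl w ** adj \<gamma> \<in> K"
    using width[OF \<gamma>(1)] by simp
  from Nor_adj_conj[OF h this]
  have C: "adj h ** (\<gamma> ** transl w ** adj \<gamma>) ** h \<in> K" .
  have hg: "h = \<gamma> ** g' ** adj \<gamma>0"
    by (simp add: geq[symmetric] g_def mul_adj[OF d0] flip: matrix_mul_assoc)
  have C_eq: "adj h ** (\<gamma> ** transl w ** adj \<gamma>) ** h = \<gamma>0 ** transl (w / t^2) ** adj \<gamma>0"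
    unfolding conj_down[symmetric] by (simp add: hg adj_mul d1 flip: matrix_mul_assoc)
  have "adj \<gamma>0 ** (\<gamma>0 ** transl (w / t^2) ** adj \<gamma>0) ** \<gamma>0 \<in> SLZ"
    using K_SLZ[OF C] unfolding C_eq by (simp add: SLZ_mult SLZ_adj \<gamma>0)
  then have "transl (w / t^2) \<in> SLZ"
    by (simp add: d0 adj_mul_self flip: matrix_mul_assoc)
  then obtain n' where n': "w / t^2 = of_int n'"
    by (auto elim: Ints_cases)
  with C C_eq width[OF \<gamma>0, of n'] obtain m' where "n' = w * m'"
    by auto
  with n' w tn0 have "t^2 * of_int m' = 1"
    by (simp add: field_simps)
  with m have "real_of_int (m * m') = 1"
    by simp
  then have "m * m' = 1"
    by linarith
  moreover have "m > 0"
    using m tn0 by (metis of_int_0_less_iff zero_less_power2)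
  ultimately have "m = 1"
    by (simp add: zmult_eq_1_iff)
  with m have "t \<in> \<int>"
    by (auto simp: power2_eq_1_iff)
  then show "(h ** \<gamma>0) $ 1 $ 1 \<in> \<int>" "(h ** \<gamma>0) $ 2 $ 1 \<in> \<int>"
    by (simp_all add: gp gq flip: g_def)
qed

text \<open>The two columns of h are the first columns of \<open>h ** mat 1\<close> and of the
  product of h with the rotation z -> -1/z.\<close>

lemma Nor_subset_SLZ:
  fixes w :: int
  assumes "w > 0"
    and "\<And>\<gamma> n. \<gamma> \<in> SLZ \<Longrightarrow> \<gamma> ** transl (of_int n) ** adj \<gamma> \<in> K \<longleftrightarrow> w dvd n"
  shows "Nor \<subseteq> SLZ"
proof
  fix h assume h: "h \<in> Nor"
  have S: "mat22 0 (- 1) 1 0 \<in> SLZ"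
    by (rule SLZ_I) (simp_all add: det_2)
  show "h \<in> SLZ"
    using Nor_column_integral[OF h assms SLZ_one] Nor_column_integral[OF h assms S] h
    by (intro SLZ_I) (simp_all add: Nor_def matmul_nth)
qed

end

section \<open>The action on the extended half-plane\<close>

definition mob :: "real^2^2 \<Rightarrow> complex \<Rightarrow> complex" where
  "mob A z = (of_real (A$1$1) * z + of_real (A$1$2)) / (of_real (A$2$1) * z + of_real (A$2$2))"

lemma mob_denom_nonzero:
  fixes A :: "real^2^2"
  assumes "det A = 1" "Im z > 0"
  shows "of_real (A$2$1) * z + of_real (A$2$2) \<noteq> 0"
proof
  assume *: "of_real (A$2$1) * z + of_real (A$2$2) = 0"
  from arg_cong[OF *, of Im] assms(2) have "A$2$1 = 0"
    by simp
  with arg_cong[OF *, of Re] assms(1) show False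
    by (simp add: det_2)
qed

lemma mat_act_Fin:
  assumes "det A = 1" "Im z > 0"
  shows "mat_act A (Fin z) = Fin (mob A z)"
  using mob_denom_nonzero[OF assms] by (simp add: mob_def moebius_def)

lemma norm_denom:
  "(cmod (of_real c * z + of_real d))\<^sup>2 = (c * Re z + d)\<^sup>2 + c\<^sup>2 * (Im z)\<^sup>2"
  by (simp add: cmod_power2 power_mult_distrib)

lemma Im_mob:
  assumes "det A = 1"
  shows "Im (mob A z) = Im z / (cmod (of_real (A$2$1) * z + of_real (A$2$2)))\<^sup>2"
proof -
  have "A$1$1 * A$2$2 - A$1$2 * A$2$1 = 1"
    using assms by (simp add: det_2)
  then have "A$1$1 * Im z * (A$2$1 * Re z + A$2$2) - (A$1$1 * Re z + A$1$2) * (A$2$1 * Im z) = Im z"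
    by algebra
  then show ?thesis
    unfolding mob_def Im_divide cmod_power2 by simp
qed

lemma Im_mob_pos:
  assumes "det A = 1" "Im z > 0"
  shows "Im (mob A z) > 0"
  using mob_denom_nonzero[OF assms] assms by (simp add: Im_mob)

lemma mob_mult:
  assumes "det B = 1" "Im z > 0"
  shows "mob (A ** B) z = mob A (mob B z)"
proof -
  let ?d = "of_real (B$2$1) * z + of_real (B$2$2)"
  have d: "?d \<noteq> 0"
    by (rule mob_denom_nonzero[OF assms])
  have "of_real x * mob B z + of_real y =
    (of_real (x * B$1$1 + y * B$2$1) * z + of_real (x * B$1$2 + y * B$2$2)) / ?d" for x y
    using d unfolding mob_def by (simp add: field_simps)
  then show ?thesis
    using d unfolding mob_def[of A] mob_def[of "A ** B"] by (simp add: matmul_nth)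
qed

lemma mob_one [simp]: "mob (mat 1) z = z"
  by (simp add: mob_def)

lemma mob_minus [simp]: "mob (- A) z = mob A z"
proof -
  have "mob (- A) z = - (of_real (A$1$1) * z + of_real (A$1$2)) / - (of_real (A$2$1) * z + of_real (A$2$2))"
    by (simp add: mob_def)
  then show ?thesis
    by (simp only: minus_divide_left[symmetric] minus_divide_right[symmetric] minus_minus mob_def)
qed

lemma mob_transl [simp]: "mob (transl x) z = z + of_real x"
  by (simp add: mob_def)

lemma mob_adj_cancel:
  assumes "det A = 1" "Im z > 0"
  shows "mob A (mob (adj A) z) = z" "mob (adj A) (mob A z) = z"
  using mob_mult[of "adj A" z A] mob_mult[of A z "adj A"] assms
  by (simp_all add: mul_adj adj_mul_self)

lemma continuous_on_mob:
  assumes "det A = 1"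
  shows "continuous_on {z. Im z > 0} (mob A)"
  unfolding mob_def using mob_denom_nonzero[OF assms] by (intro continuous_intros) auto

lemma mat_act_minus: "mat_act (- A) p = mat_act A p"
proof (cases p)
  case (Fin z)
  have "- (of_real (A$2$1) * z) - of_real (A$2$2) = - (of_real (A$2$1) * z + of_real (A$2$2))"
    by simp
  then have "- (of_real (A$2$1) * z) - of_real (A$2$2) = 0 \<longleftrightarrow> of_real (A$2$1) * z + of_real (A$2$2) = 0"
    by (simp only: neg_equal_0_iff_equal)
  then show ?thesis
    using mob_minus[of A z] Fin by (simp add: moebius_def mob_def)
qed simp

lemma psl_act_pclass [simp]: "psl_act (pclass A) p = mat_act A p"
  by (simp add: psl_act_def pclass_def mat_act_minus)

lemma mat_act_one: "mat_act (mat 1) p = p"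
  by (cases p) (simp_all add: moebius_def)

lemma mat_act_mult_Infty:
  assumes "det A = 1" "det B = 1"
  shows "mat_act (A ** B) Infty = mat_act A (mat_act B Infty)"
proof (cases "B$2$1 = 0")
  case True
  then have "B$1$1 \<noteq> 0"
    using assms(2) by (auto simp: det_2)
  then show ?thesis
    using True by (simp add: matmul_nth)
next
  case False
  have "of_real (A$2$1) * (of_real (B$1$1 / B$2$1)) + of_real (A$2$2)
      = complex_of_real ((A ** B)$2$1 / B$2$1)"
    using False by (simp add: matmul_nth field_simps)
  moreover have "of_real (A$1$1) * (of_real (B$1$1 / B$2$1)) + of_real (A$1$2)
      = complex_of_real ((A ** B)$1$1 / B$2$1)"
    using False by (simp add: matmul_nth field_simps)
  ultimately show ?thesis
    using False by (simp add: moebius_def del: of_real_divide) simp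
qed

lemma mat_act_real_not_upper:
  assumes "mat_act A (Fin (of_real x)) = Fin z"
  shows "Im z = 0"
proof -
  have "z \<in> \<real>"
    using assms by (auto simp: moebius_def split: if_splits)
  then show ?thesis
    by (simp add: complex_is_Real_iff)
qed

lemma mat_act_Infty_not_upper: "mat_act A Infty = Fin z \<Longrightarrow> Im z = 0"
  by (auto split: if_splits)

text \<open>A numerator and a denominator in lowest terms complete to an integral matrix of
  determinant 1. Every cusp can thus be moved to \<infinity>.\<close>

lemma boundary_cusps_eq: "boundary_cusps = (\<lambda>A. mat_act A Infty) ` SLZ"
proof (intro equalityI subsetI)
  fix s assume "s \<in> boundary_cusps"
  then consider "s = Infty" | r :: rat where "s = Fin (of_rat r)"
    by (auto simp: boundary_cusps_def)
  then show "s \<in> (\<lambda>A. mat_act A Infty) ` SLZ"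
  proof cases
    case 1
    then show ?thesis
      using SLZ_one by (auto intro!: rev_image_eqI[of "mat 1"])
  next
    case 2
    obtain p q where pq: "quotient_of r = (p, q)"
      by fastforce
    have "q > 0" "coprime p q" "r = of_int p / of_int q"
      using quotient_of_denom_pos[OF pq] quotient_of_coprime[OF pq] quotient_of_div[OF pq] by auto
    moreover obtain A where "A \<in> SLZ" "A$1$1 = p" "A$2$1 = q"
      using ex_SLZ_column[OF \<open>coprime p q\<close>] by blast
    ultimately show ?thesis
      using 2 by (intro rev_image_eqI[of A]) (auto simp: of_rat_divide)
  qed
next
  fix s assume "s \<in> (\<lambda>A. mat_act A Infty) ` SLZ"
  then obtain A where A: "A \<in> SLZ" "s = mat_act A Infty"
    by blast
  obtain p q :: int where "A$1$1 = p" "A$2$1 = q"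
    using SLZ_Ints[OF A(1)] by (metis Ints_cases)
  then have "s = Infty \<or> s = Fin (of_rat (of_int p / of_int q))"
    using A(2) by (auto simp: of_rat_divide)
  then show "s \<in> boundary_cusps"
    by (auto simp: boundary_cusps_def)
qed

lemma Ints_square_ge_1: "x \<in> \<int> \<Longrightarrow> x \<noteq> 0 \<Longrightarrow> x\<^sup>2 \<ge> (1::real)"
  using Ints_nonzero_abs_ge1[of x] abs_le_square_iff[of 1 x] by simp

text \<open>The images of the horoball \<open>Im z > 1\<close> under \<open>SL2Z\<close> are equal or disjoint.\<close>

lemma SLZ_lower_left_zero:
  assumes A: "A \<in> SLZ" and z: "Im z > 1" and Az: "Im (mob A z) > 1"
  shows "A$2$1 = 0"
proof (rule ccontr)
  assume "A$2$1 \<noteq> 0"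
  let ?N = "(cmod (of_real (A$2$1) * z + of_real (A$2$2)))\<^sup>2"
  have "Im z \<le> (Im z)\<^sup>2"
    using z by (simp add: power2_eq_square)
  also have "\<dots> \<le> (A$2$1)\<^sup>2 * (Im z)\<^sup>2"
    using Ints_square_ge_1[OF SLZ_Ints[OF A] \<open>A$2$1 \<noteq> 0\<close>]
      mult_right_mono[of 1 "(A$2$1)\<^sup>2" "(Im z)\<^sup>2"] by simp
  also have "\<dots> \<le> ?N"
    by (simp add: norm_denom)
  finally have "Im z \<le> ?N" .
  then have "Im z / ?N \<le> 1"
    using z by (subst divide_le_eq_1_pos) linarith+
  then show False
    using Az by (simp add: Im_mob[OF SLZ_det[OF A]])
qed

section \<open>Horoballs\<close>

definition upper_part :: "real \<Rightarrow> complex set" where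
  "upper_part Y = {z. Im z > Y}"

text \<open>When the squared distance to the centre s + i r is expanded, the terms r^2
  cancel.\<close>

lemma mem_horoball_Fin_iff:
  fixes s :: real
  assumes "r > 0"
  shows "w \<in> horoball r (Fin (of_real s)) \<longleftrightarrow> (cmod (w - of_real s))\<^sup>2 < 2 * r * Im w"
proof -
  have "w \<in> horoball r (Fin (of_real s)) \<longleftrightarrow> (cmod (w - (of_real s + \<i> * of_real r)))\<^sup>2 < r\<^sup>2"
  proof -
    let ?v = "cmod (w - (of_real s + \<i> * of_real r))"
    have "?v < r \<longleftrightarrow> ?v\<^sup>2 < r\<^sup>2"
      using assms power2_less_imp_less[of ?v r] power_strict_mono[of ?v r 2] by auto
    then show ?thesis
      by (simp add: dist_norm norm_minus_commute)
  qed
  then show ?thesis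
    unfolding cmod_power2 by (simp add: power2_eq_square algebra_simps)
qed

text \<open>With c = \<open>A$2$1\<close> and D = c z + d, the image lies at distance 1 / (|c| |D|)
  from the cusp and has height Im z / |D|^2, so |D| cancels from the condition for the tangent disc.
  For c = 0 the map is an integral translation.\<close>

lemma mob_mem_horoball_iff:
  assumes A: "A \<in> SLZ" and r: "r > 0" and z: "Im z > 0"
  shows "mob A z \<in> horoball r (mat_act A Infty) \<longleftrightarrow>
    Im z > (if A$2$1 = 0 then 1 / r else 1 / (2 * r * (A$2$1)\<^sup>2))"
proof (cases "A$2$1 = 0")
  case True
  then obtain n :: int where "A = transl n \<or> A = - transl n"
    using SLZ_upper_triangular[OF A] by blast
  then have "mob A z = z + n"
    by auto
  then show ?thesis
    using True by simp
next
  case False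
  let ?c = "A$2$1"
  let ?D = "of_real ?c * z + of_real (A$2$2)"
  have dA: "det A = 1"
    by (rule SLZ_det[OF A])
  have D: "?D \<noteq> 0"
    by (rule mob_denom_nonzero[OF dA z])
  have "complex_of_real (A$1$1 * A$2$2 - A$1$2 * ?c) = 1"
    using dA by (simp add: det_2)
  then have "mob A z - of_real (A$1$1 / ?c) = - 1 / (of_real ?c * ?D)"
    using D False unfolding mob_def by (simp add: field_simps)
  then have "(cmod (mob A z - of_real (A$1$1 / ?c)))\<^sup>2 = 1 / (?c\<^sup>2 * (cmod ?D)\<^sup>2)"
    by (simp add: norm_divide norm_mult power_mult_distrib power_divide)
  moreover have "mat_act A Infty = Fin (of_real (A$1$1 / ?c))"
    using False by simp
  ultimately have "mob A z \<in> horoball r (mat_act A Infty) \<longleftrightarrow>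
      1 / (?c\<^sup>2 * (cmod ?D)\<^sup>2) < 2 * r * (Im z / (cmod ?D)\<^sup>2)"
    by (simp only: mem_horoball_Fin_iff[OF r] Im_mob[OF dA])
  also have "\<dots> \<longleftrightarrow> 1 / (2 * r * ?c\<^sup>2) < Im z"
    using D False r by (simp add: field_simps)
  finally show ?thesis
    using False by simp
qed

lemma horoball_upper:
  assumes "A \<in> SLZ" "r > 0" "w \<in> horoball r (mat_act A Infty)"
  shows "Im w > 0"
proof (cases "A$2$1 = 0")
  case True
  with assms(3) have "1 / r < Im w"
    by simp
  moreover have "1 / r > 0"
    using assms(2) by simp
  ultimately show ?thesis
    by linarith
next
  case False
  then have "w \<in> horoball r (Fin (of_real (A$1$1 / A$2$1)))"
    using assms(3) by simp
  then have "0 < 2 * r * Im w"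
    unfolding mem_horoball_Fin_iff[OF assms(2)] by (smt (verit) zero_le_power2)
  then show ?thesis
    using assms(2) by (simp add: zero_less_mult_iff)
qed

text \<open>The height Y is inversely proportional to r. Once it is at least 1,
  \<open>SLZ_lower_left_zero\<close> applies, and points can be identified only by elements fixing
  the cusp.\<close>

lemma eventually_horoball_eq:
  assumes A: "A \<in> SLZ"
  shows "\<forall>\<^sub>F r in at_right 0. \<exists>Y\<ge>1. horoball r (mat_act A Infty) = mob A ` upper_part Y"
proof -
  \<comment> \<open>The radius for which the height \<open>?Y\<close> below equals 1.\<close>
  define e where "e = (if A$2$1 = 0 then 1 else 1 / (2 * (A$2$1)\<^sup>2))"
  have e: "e > 0"
    by (simp add: e_def)
  have "\<exists>Y\<ge>1. horoball r (mat_act A Infty) = mob A ` upper_part Y" if r: "0 < r" "r < e" for r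
  proof (intro exI conjI)
    let ?Y = "if A$2$1 = 0 then 1 / r else 1 / (2 * r * (A$2$1)\<^sup>2)"
    show Y: "1 \<le> ?Y"
      using r by (auto simp: e_def field_simps split: if_splits)
    have dA: "det A = 1"
      by (rule SLZ_det[OF A])
    show "horoball r (mat_act A Infty) = mob A ` upper_part ?Y"
    proof (intro equalityI subsetI)
      fix w assume w: "w \<in> horoball r (mat_act A Infty)"
      let ?z = "mob (adj A) w"
      have "Im w > 0"
        by (rule horoball_upper[OF A r(1) w])
      then have z: "Im ?z > 0" "mob A ?z = w"
        by (simp_all add: Im_mob_pos dA mob_adj_cancel)
      then have "?z \<in> upper_part ?Y"
        using mob_mem_horoball_iff[OF A r(1) z(1)] w unfolding upper_part_def by simp
      with z(2) show "w \<in> mob A ` upper_part ?Y"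
        by (metis imageI)
    next
      fix w assume "w \<in> mob A ` upper_part ?Y"
      then obtain z where z: "w = mob A z" "Im z > ?Y"
        unfolding upper_part_def by blast
      with Y have "Im z > 0"
        by linarith
      then show "w \<in> horoball r (mat_act A Infty)"
        using mob_mem_horoball_iff[OF A r(1)] z by simp
    qed
  qed
  then show ?thesis
    using e by (auto simp: eventually_at_right_field)
qed

section \<open>The edges near a cusp\<close>

lemma sin_pi_3_ge: "sin (pi / 3) \<ge> 1 / 2"
proof -
  have "sqrt 1 \<le> sqrt 3"
    by (simp only: real_sqrt_le_iff)
  then show ?thesis
    by (simp add: sin_60)
qed

text \<open>The circle |z - 1| = 1 takes the form |z|^2 = 2 Re z, from which Re (1 / z) = 1 / 2 can
  be read off. The lower end of the edge over 1 / 2 is relaxed to height 1 / 2.\<close>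

lemma mem_triangle_edgesE:
  assumes "e \<in> triangle_edges" "p \<in> e"
  obtains "p = Fin 0" | "p = Infty"
  | z where "p = Fin z" "Im z > 0" "Re z = 0"
  | z where "p = Fin z" "Im z \<ge> 1 / 2" "Re z = 1 / 2"
  | z where "p = Fin z" "Im z > 0" "(cmod z)\<^sup>2 = 2 * Re z" "Re z \<le> 1 / 2"
proof -
  have *: "(cmod z)\<^sup>2 = 2 * Re z" if "cmod (z - 1) = 1" for z
  proof -
    have "(cmod (z - 1))\<^sup>2 = 1"
      using that by simp
    then show ?thesis
      unfolding cmod_power2 by (simp add: power2_eq_square algebra_simps)
  qed
  show ?thesis
    using assms that * sin_pi_3_ge unfolding triangle_edges_def
    by (auto simp: cos_60)
qed

text \<open>With N = |c z + d|^2 the hypothesis on the height reads N < Im z. If c = 0, A is a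
  translation up to sign and only the vertical edges are high enough. If d = 0, the edges through 0
  are inverted into vertical lines. In all other cases N \<ge> Im z, a contradiction.\<close>

lemma mob_edge_near_infinity:
  assumes A: "A \<in> SLZ" and y: "Im z > 0" and Az: "Im (mob A z) > 1"
    and edge: "Re z = 0 \<or> Re z = 1 / 2 \<and> Im z \<ge> 1 / 2 \<or> (cmod z)\<^sup>2 = 2 * Re z \<and> Re z \<le> 1 / 2"
  shows "2 * Re (mob A z) \<in> \<int>"
proof -
  define c d where "c = A$2$1" and "d = A$2$2"
  have Ints: "c \<in> \<int>" "d \<in> \<int>" "A$1$1 \<in> \<int>" "A$1$2 \<in> \<int>"
    by (simp_all add: c_def d_def SLZ_Ints[OF A])
  have dA: "det A = 1"
    by (rule SLZ_det[OF A])
  define N where "N = (c * Re z + d)\<^sup>2 + c\<^sup>2 * (Im z)\<^sup>2"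
  have "Im (mob A z) = Im z / N"
    unfolding Im_mob[OF dA] norm_denom N_def c_def d_def ..
  moreover have "N > 0"
    using mob_denom_nonzero[OF dA y] unfolding N_def norm_denom[symmetric] c_def d_def by simp
  ultimately have N: "N < Im z"
    using mult_strict_left_mono[OF Az \<open>N > 0\<close>] by simp
  \<comment> \<open>For y = Im z this is t^2 + y^2 \<ge> 1/4 + y^2 \<ge> y, where the last step is
    (y - 1/2)^2 \<ge> 0.\<close>
  have sq: "Im z \<le> t\<^sup>2 + (Im z)\<^sup>2" if "t\<^sup>2 \<ge> 1 / 4" for t
    using that zero_le_power2[of "Im z - 1 / 2"] by (simp add: power2_eq_square algebra_simps)
  show ?thesis
  proof (cases "c = 0")
    case True
    then obtain n :: int where "A = transl n \<or> A = - transl n"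
      using SLZ_upper_triangular[OF A] unfolding c_def by blast
    then have mob: "mob A z = z + n"
      by auto
    \<comment> \<open>The arc lies on a circle of radius 1 about a real point and so has height at
      most 1, whereas here Im z > 1.\<close>
    have "\<not> ((cmod z)\<^sup>2 = 2 * Re z)"
    proof
      assume "(cmod z)\<^sup>2 = 2 * Re z"
      then have "(Im z)\<^sup>2 = 1 - (Re z - 1)\<^sup>2"
        unfolding cmod_power2 by (simp add: power2_eq_square algebra_simps)
      then have "(Im z)\<^sup>2 \<le> 1"
        by simp
      then show False
        using Az mob abs_square_le_1[of "Im z"] by simp
    qed
    then have "2 * Re z = 0 \<or> 2 * Re z = 1"
      using edge by auto
    then show ?thesis
      by (auto simp: mob distrib_left)
  next
    case c: False
    then have c1: "c\<^sup>2 \<ge> 1"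
      by (rule Ints_square_ge_1[OF Ints(1)])
    then have cy: "(Im z)\<^sup>2 \<le> c\<^sup>2 * (Im z)\<^sup>2"
      using mult_right_mono[OF c1, of "(Im z)\<^sup>2"] by simp
    \<comment> \<open>Here c * Re z + d is half of the integer c + 2 d. If it vanishes, c is even
      and c^2 \<ge> 4 compensates; otherwise its square is at least 1/4.\<close>
    have not_half: "\<not> (Re z = 1 / 2 \<and> Im z \<ge> 1 / 2)"
    proof
      assume h: "Re z = 1 / 2 \<and> Im z \<ge> 1 / 2"
      show False
      proof (cases "c + 2 * d = 0")
        case True
        then have "d \<noteq> 0" "c = - 2 * d"
          using c by auto
        then have "c\<^sup>2 \<ge> 4"
          using Ints_square_ge_1[OF Ints(2)] by (simp add: power_mult_distrib)
        then have "4 * (Im z)\<^sup>2 \<le> c\<^sup>2 * (Im z)\<^sup>2"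
          by (intro mult_right_mono) simp_all
        then have "4 * (Im z)\<^sup>2 \<le> N"
          using zero_le_power2[of "c * Re z + d"] unfolding N_def by linarith
        moreover have "Im z * (1 / 2) \<le> Im z * Im z"
          using h by (intro mult_left_mono) auto
        ultimately show False
          using N y by (simp add: power2_eq_square)
      next
        case False
        then have "(c + 2 * d)\<^sup>2 \<ge> 1"
          using Ints by (intro Ints_square_ge_1) auto
        moreover have "(c * Re z + d)\<^sup>2 = (c + 2 * d)\<^sup>2 / 4"
          unfolding conjunct1[OF h] by (simp add: power2_eq_square field_simps)
        ultimately have "(c * Re z + d)\<^sup>2 \<ge> 1 / 4"
          by linarith
        from sq[OF this] show False
          using N cy unfolding N_def by linarith
      qed
    qed
    show ?thesis
    proof (cases "d = 0")
      case True
      then have bc: "A$1$2 * c = - 1"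
        using dA by (simp add: det_2 c_def d_def)
      \<comment> \<open>The entry c is a unit, so the image of z is -(a b) - b^2 / z with integral
        coefficients.\<close>
      have inv: "inverse c = - A$1$2"
        by (rule inverse_unique) (use bc in \<open>simp add: mult.commute\<close>)
      have z0: "z \<noteq> 0"
        using y by auto
      have "mob A z = of_real (A$1$1 / c) + of_real (A$1$2 / c) / z"
        using True c z0 by (simp add: mob_def c_def d_def field_simps)
      moreover have "A$1$1 / c = - (A$1$1 * A$1$2)" "A$1$2 / c = - ((A$1$2)\<^sup>2)"
        by (simp_all add: divide_inverse inv power2_eq_square)
      ultimately have mob: "mob A z = - of_real (A$1$1 * A$1$2) - of_real ((A$1$2)\<^sup>2) / z"
        by simp
      have Re: "Re (mob A z) = - (A$1$1 * A$1$2) - (A$1$2)\<^sup>2 * (Re z / (cmod z)\<^sup>2)"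
        unfolding mob by (simp add: Re_divide cmod_power2)
      \<comment> \<open>This is Re (1 / z): it is 0 on the imaginary axis and 1/2 on the
        arc.\<close>
      have "Re z / (cmod z)\<^sup>2 = 0 \<or> Re z / (cmod z)\<^sup>2 = 1 / 2"
        using edge not_half z0 by (auto simp: field_simps)
      then show ?thesis
        using Ints unfolding Re by (auto simp: algebra_simps)
    next
      case d: False
      then have d1: "d\<^sup>2 \<ge> 1"
        by (rule Ints_square_ge_1[OF Ints(2)])
      show ?thesis
      proof (cases "Re z = 0")
        case True
        then have "N = d\<^sup>2 + c\<^sup>2 * (Im z)\<^sup>2"
          by (simp add: N_def)
        then show ?thesis
          using sq[of d] N cy d1 by simp
      next
        case False
        then have circ: "(cmod z)\<^sup>2 = 2 * Re z" and x: "Re z \<le> 1 / 2"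
          using edge not_half by auto
        have y2: "(Im z)\<^sup>2 = 2 * Re z - (Re z)\<^sup>2"
          using circ unfolding cmod_power2 by simp
        then have "(Im z)\<^sup>2 = 1 - (Re z - 1)\<^sup>2"
          by (simp add: power2_eq_square algebra_simps)
        then have "(Im z)\<^sup>2 \<le> 1"
          by simp
        then have "Im z \<le> 1"
          by (simp add: power_le_one_iff abs_square_le_1)
        have x0: "Re z \<ge> 0"
          using circ by (metis zero_le_power2 zero_le_mult_iff zero_less_numeral not_less)
        \<comment> \<open>On the arc, N equals x c^2 + (1 - x) d^2 + x (c + d)^2 with x = Re z
          between 0 and 1/2; the first two terms already add up to at least 1.\<close>
        have "1 = Re z * 1 + (1 - Re z) * 1 + 0"
          by simp
        also have "\<dots> \<le> Re z * c\<^sup>2 + (1 - Re z) * d\<^sup>2 + Re z * (c + d)\<^sup>2"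
          using c1 d1 x x0 by (intro add_mono mult_left_mono) simp_all
        also have "\<dots> = N"
          unfolding N_def y2 by (simp add: power2_eq_square algebra_simps)
        finally have "1 \<le> N" .
        with N \<open>Im z \<le> 1\<close> show ?thesis
          by linarith
      qed
    qed
  qed
qed

lemma edge_near_infinity_iff:
  assumes z: "Im z > 1"
  shows "(\<exists>A\<in>SLZ. \<exists>e\<in>triangle_edges. \<exists>p\<in>e. mat_act A p = Fin z) \<longleftrightarrow> 2 * Re z \<in> \<int>"
proof
  assume "\<exists>A\<in>SLZ. \<exists>e\<in>triangle_edges. \<exists>p\<in>e. mat_act A p = Fin z"
  then obtain A e p where A: "A \<in> SLZ" and e: "e \<in> triangle_edges" "p \<in> e"
    and p: "mat_act A p = Fin z"
    by blast
  have "p \<noteq> Fin 0" "p \<noteq> Infty"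
    using p z mat_act_real_not_upper[of A 0 z] mat_act_Infty_not_upper[of A z] by auto
  then obtain u where u: "p = Fin u" "Im u > 0"
    "Re u = 0 \<or> Re u = 1 / 2 \<and> Im u \<ge> 1 / 2 \<or> (cmod u)\<^sup>2 = 2 * Re u \<and> Re u \<le> 1 / 2"
    using mem_triangle_edgesE[OF e] by (smt (verit) divide_pos_pos)
  have "mob A u = z"
    using p mat_act_Fin[OF SLZ_det[OF A] u(2)] u(1) by simp
  then show "2 * Re z \<in> \<int>"
    using mob_edge_near_infinity[OF A u(2) _ u(3)] z by simp
next
  assume "2 * Re z \<in> \<int>"
  then obtain k where k: "2 * Re z = of_int k"
    by (auto elim: Ints_cases)
  \<comment> \<open>An integral translation moves z to real part 0 or 1/2 according to the parity of
    2 Re z; as Im z > 1, the result lies on one of the two vertical edges.\<close>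
  define n where "n = k div 2"
  define u where "u = z - of_int n"
  have u: "mat_act (transl n) (Fin u) = Fin z"
    by (simp add: u_def moebius_def)
  have "k = 2 * n + k mod 2"
    by (simp add: n_def)
  then have "Re z = of_int n + of_int (k mod 2) / 2"
    using k by linarith
  then have "Re u = 0 \<or> Re u = 1 / 2"
    unfolding u_def by (cases "k mod 2 = 0") auto
  moreover have "Im u > 1"
    using z by (simp add: u_def)
  moreover from this have "sin (pi / 3) \<le> Im u"
    by (smt (verit) sin_le_one)
  ultimately have "\<exists>e\<in>triangle_edges. Fin u \<in> e"
    unfolding triangle_edges_def by (auto simp: cos_60 image_iff)
  moreover have "transl n \<in> SLZ"
    by simp
  ultimately show "\<exists>A\<in>SLZ. \<exists>e\<in>triangle_edges. \<exists>p\<in>e. mat_act A p = Fin z"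
    using u by blast
qed

section \<open>Open partitions and half-strips\<close>

text \<open>The complement of a piece is the union of the others, so each piece is both open and
  closed; being connected, it is the component of each of its points.\<close>

lemma connected_components_of_open_partition:
  assumes op: "\<And>U. U \<in> \<U> \<Longrightarrow> openin X U"
    and conn: "\<And>U. U \<in> \<U> \<Longrightarrow> connectedin X U"
    and ne: "\<And>U. U \<in> \<U> \<Longrightarrow> U \<noteq> {}"
    and disj: "pairwise disjnt \<U>"
    and un: "\<Union>\<U> = topspace X"
  shows "connected_components_of X = \<U>"
proof -
  have comp: "connected_component_of_set X x = U" if U: "U \<in> \<U>" "x \<in> U" for U x
  proof (rule antisym)
    show "U \<subseteq> connected_component_of_set X x"
      using connected_component_of_maximal[OF conn[OF U(1)] U(2)] .
    have "topspace X - U = \<Union>(\<U> - {U})"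
      using diff_Union_pairwise_disjoint[OF disj, of "{U}"] U(1) un by simp
    then have "openin X (topspace X - U)"
      using op by auto
    then have "closedin X U"
      using op[OF U(1)] by (simp add: closedin_def openin_subset)
    moreover have "x \<in> connected_component_of_set X x"
      using U un by (auto simp: connected_component_of_refl)
    ultimately show "connected_component_of_set X x \<subseteq> U"
      using connectedin_clopen_cases[OF connectedin_connected_component_of _ op[OF U(1)], of x] U(2)
      unfolding disjnt_def by blast
  qed
  show ?thesis
  proof (intro equalityI subsetI)
    fix C assume "C \<in> connected_components_of X"
    then obtain x where "x \<in> topspace X" "C = connected_component_of_set X x"
      by (auto simp: connected_components_of_def)
    then show "C \<in> \<U>"
      using comp un by blast
  next
    fix U assume U: "U \<in> \<U>"
    then obtain x where "x \<in> U"
      using ne by blast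
    then show "U \<in> connected_components_of X"
      using comp[OF U] U un unfolding connected_components_of_def by blast
  qed
qed

text \<open>Division with remainder by the least positive element; the trivial subgroup has
  generator 0.\<close>

lemma int_subgroup_generator:
  assumes "0 \<in> W" and diff: "\<And>m n. m \<in> W \<Longrightarrow> n \<in> W \<Longrightarrow> m - n \<in> W"
  obtains w :: int where "w \<ge> 0" "\<And>n. n \<in> W \<longleftrightarrow> w dvd n"
proof (cases "W = {0}")
  case True
  then show thesis
    using that[of 0] by auto
next
  case False
  have neg: "- n \<in> W" if "n \<in> W" for n
    using diff[OF assms(1) that] by simp
  have add: "m + n \<in> W" if "m \<in> W" "n \<in> W" for m n
    using diff[OF that(1) neg[OF that(2)]] by simp
  obtain n0 where "n0 \<in> W" "n0 \<noteq> 0"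
    using False assms(1) by blast
  then have "\<exists>k. k > 0 \<and> int k \<in> W"
    using neg[of n0] by (intro exI[of _ "nat \<bar>n0\<bar>"]) (auto simp: abs_if)
  define k where "k = (LEAST k. k > 0 \<and> int k \<in> W)"
  have k: "k > 0" "int k \<in> W"
    using LeastI_ex[OF \<open>\<exists>k. k > 0 \<and> int k \<in> W\<close>] by (simp_all add: k_def)
  have mult_nat: "int k * int j \<in> W" for j
    by (induction j) (use assms(1) add k(2) in \<open>simp_all add: algebra_simps\<close>)
  have mult: "int k * j \<in> W" for j
    using mult_nat[of "nat j"] neg[OF mult_nat[of "nat (- j)"]] by (cases "j \<ge> 0") simp_all
  have "int k dvd n" if "n \<in> W" for n
  proof (rule ccontr)
    assume "\<not> int k dvd n"
    then have "n mod int k \<noteq> 0"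
      by (simp add: mod_eq_0_iff_dvd)
    moreover have "n mod int k \<ge> 0"
      using k(1) by simp
    ultimately have "n mod int k > 0"
      by linarith
    moreover have "n mod int k \<in> W"
      using diff[OF that mult[of "n div int k"]] by (simp add: minus_mult_div_eq_mod)
    ultimately have "k \<le> nat (n mod int k)"
      unfolding k_def by (intro Least_le) simp
    then show False
      using k(1) pos_mod_bound[of "int k" n] by linarith
  qed
  then show thesis
    using that[of "int k"] mult by auto
qed

text \<open>The vertex 0 is the image of \<infinity> under the rotation z -> -1/z, which reduces it
  to \<open>mat_act_mult_Infty\<close>. The points allowed cover all points of the edges of the
  triangle.\<close>

lemma mat_act_mult:
  assumes "det A = 1" "det B = 1" and p: "p = Infty \<or> p = Fin 0 \<or> (\<exists>u. p = Fin u \<and> Im u > 0)"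
  shows "mat_act (A ** B) p = mat_act A (mat_act B p)"
proof -
  let ?S = "mat22 0 (- 1) 1 0"
  have S: "det ?S = 1" "mat_act ?S Infty = Fin 0"
    by (simp_all add: det_2)
  consider "p = Infty" | "p = Fin 0" | u where "p = Fin u" "Im u > 0"
    using p by blast
  then show ?thesis
  proof cases
    case 1
    then show ?thesis
      using mat_act_mult_Infty[OF assms(1,2)] by simp
  next
    case 2
    have "mat_act C (Fin 0) = mat_act (C ** ?S) Infty" if "det C = 1" for C
      by (simp only: mat_act_mult_Infty[OF that S(1)] S(2))
    then show ?thesis
      using mat_act_mult_Infty[of A "B ** ?S"] 2 assms S(1) by (simp add: det_mul matrix_mul_assoc)
  next
    case 3
    then show ?thesis
      using assms by (simp add: mat_act_Fin Im_mob_pos mob_mult det_mul del: mat_act.simps)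
  qed
qed

lemma triangle_edges_point:
  assumes "e \<in> triangle_edges" "p \<in> e"
  shows "p = Infty \<or> p = Fin 0 \<or> (\<exists>u. p = Fin u \<and> Im u > 0)"
  using mem_triangle_edgesE[OF assms] by (smt (verit) divide_pos_pos)

text \<open>The image is a preimage under the inverse map, which is continuous on the
  half-plane.\<close>

lemma open_mob_image:
  assumes A: "det A = 1" and S: "open S" "S \<subseteq> upper_half_plane"
  shows "open (mob A ` S)"
proof -
  have "mob A ` S = {z. Im z > 0} \<inter> mob (adj A) -` S"
  proof (intro equalityI subsetI)
    fix w assume "w \<in> mob A ` S"
    then show "w \<in> {z. Im z > 0} \<inter> mob (adj A) -` S"
      using S(2) A by (auto simp: upper_half_plane_def Im_mob_pos mob_adj_cancel)
  next
    fix w assume w: "w \<in> {z. Im z > 0} \<inter> mob (adj A) -` S"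
    then have "w = mob A (mob (adj A) w)"
      using A by (simp add: mob_adj_cancel)
    then show "w \<in> mob A ` S"
      using w by blast
  qed
  then show ?thesis
    using continuous_open_preimage[OF continuous_on_mob[of "adj A"] open_halfspace_Im_gt S(1)] A
    by simp
qed

definition strip :: "real \<Rightarrow> int \<Rightarrow> complex set" where
  "strip Y k = {z. of_int k < 2 * Re z \<and> 2 * Re z < of_int k + 1 \<and> Im z > Y}"

lemma strip_eq:
  "strip Y k = {z. Re z > of_int k / 2} \<inter> {z. Re z < (of_int k + 1) / 2} \<inter> {z. Im z > Y}"
  by (auto simp: strip_def field_simps)

lemma open_strip: "open (strip Y k)"
  unfolding strip_eq by (intro open_Int open_halfspace_Re_gt open_halfspace_Re_lt open_halfspace_Im_gt)

lemma connected_strip: "connected (strip Y k)"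
  unfolding strip_eq
  by (intro convex_connected convex_Int convex_halfspace_Re_gt convex_halfspace_Re_lt
      convex_halfspace_Im_gt)

lemma strip_nonempty: "strip Y k \<noteq> {}"
proof -
  have "Complex ((of_int k + 1 / 2) / 2) (Y + 1) \<in> strip Y k"
    by (simp add: strip_def)
  then show ?thesis
    by blast
qed

lemma Union_strip: "(\<Union>k. strip Y k) = {z \<in> upper_part Y. 2 * Re z \<notin> \<int>}"
proof (intro equalityI subsetI)
  fix z assume "z \<in> (\<Union>k. strip Y k)"
  then obtain k :: int where k: "of_int k < 2 * Re z" "2 * Re z < of_int k + 1" "Im z > Y"
    by (auto simp: strip_def)
  have "2 * Re z \<noteq> of_int n" for n :: int
  proof
    assume "2 * Re z = of_int n"
    with k have "k < n" "n < k + 1"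
      by linarith+
    then show False
      by simp
  qed
  then show "z \<in> {z \<in> upper_part Y. 2 * Re z \<notin> \<int>}"
    using k by (auto simp: upper_part_def elim: Ints_cases)
next
  fix z assume z: "z \<in> {z \<in> upper_part Y. 2 * Re z \<notin> \<int>}"
  then have "of_int \<lfloor>2 * Re z\<rfloor> \<noteq> 2 * Re z"
    by (metis (mono_tags, lifting) Ints_of_int mem_Collect_eq)
  then have "of_int \<lfloor>2 * Re z\<rfloor> < 2 * Re z" "2 * Re z < of_int \<lfloor>2 * Re z\<rfloor> + 1"
    by linarith+
  then have "z \<in> strip Y \<lfloor>2 * Re z\<rfloor>"
    using z by (simp add: strip_def upper_part_def)
  then show "z \<in> (\<Union>k. strip Y k)"
    by blast
qed

lemma strip_translate: "z + of_int n \<in> strip Y j \<longleftrightarrow> z \<in> strip Y (j - 2 * n)"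
  by (auto simp: strip_def)

lemma strip_disjoint: "z \<in> strip Y j \<Longrightarrow> z \<in> strip Y k \<Longrightarrow> j = k"
  unfolding strip_def by (auto; linarith)

text \<open>The values correspond to the residues modulo m; for m = 0 the function is injective on
  the integers.\<close>

lemma ecard_range_periodic:
  fixes f :: "int \<Rightarrow> 'a"
  assumes f: "\<And>j k. f j = f k \<longleftrightarrow> m dvd k - j" and m: "m \<ge> 0"
  shows "ecard (range f) = (if m = 0 then \<infinity> else enat (nat m))"
proof (cases "m = 0")
  case True
  then have "inj f"
    using f by (auto intro!: injI)
  then have "infinite (range f)"
    using finite_imageD infinite_UNIV_int by blast
  then show ?thesis
    using True by (simp add: ecard_def)
next
  case False
  have "f k = f (k mod m)" for k
    unfolding f by (metis dvd_minus_mod minus_diff_eq dvd_minus_iff)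
  moreover have "k mod m \<in> {0..<m}" for k
    using False m by simp
  ultimately have range: "range f = f ` {0..<m}"
    by (metis (no_types, lifting) UNIV_I image_iff subset_antisym image_mono subset_UNIV image_subsetI)
  have "inj_on f {0..<m}"
  proof (rule inj_onI)
    fix j k assume jk: "j \<in> {0..<m}" "k \<in> {0..<m}" "f j = f k"
    then have "k mod m = j mod m"
      unfolding f by (simp only: mod_eq_dvd_iff)
    then show "j = k"
      using jk(1,2) by (metis atLeastLessThan_iff mod_pos_pos_trivial)
  qed
  then show ?thesis
    using False by (simp add: range ecard_def card_image)
qed

text \<open>Identifying half-strips by translations through multiples of w amounts to congruence of
  their indices modulo 2 w.\<close>

lemma two_times_dvd_iff: "(\<exists>n. w dvd n \<and> j = k + 2 * n) \<longleftrightarrow> 2 * w dvd j - k" for w j k :: int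
proof
  assume "\<exists>n. w dvd n \<and> j = k + 2 * n"
  then show "2 * w dvd j - k"
    by (auto simp: mult_dvd_mono)
next
  assume "2 * w dvd j - k"
  then obtain m where "j - k = 2 * w * m"
    by blast
  then show "\<exists>n. w dvd n \<and> j = k + 2 * n"
    by (intro exI[of _ "w * m"]) auto
qed

context modular_subgroup
begin

section \<open>Sectors at a cusp\<close>

lemma G_orbit_eq: "G_orbit G p = (\<lambda>B. mat_act B p) ` K"
  by (auto simp: G_orbit_def orbit_def in_G_iff image_iff) (metis in_G_iff psl_act_pclass)

lemma mem_G_orbit: "p \<in> G_orbit G p"
  unfolding G_orbit_eq by (rule rev_image_eqI[OF K_one]) (simp add: mat_act_one)

lemma G_orbit_Fin: "Im z > 0 \<Longrightarrow> G_orbit G (Fin z) = (\<lambda>B. Fin (mob B z)) ` K"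
  unfolding G_orbit_eq by (intro image_cong refl) (simp add: mat_act_Fin K_det del: mat_act.simps)

lemma G_orbit_Fin_eq_iff:
  assumes z: "Im z > 0" and z': "Im z' > 0"
  shows "G_orbit G (Fin z) = G_orbit G (Fin z') \<longleftrightarrow> (\<exists>B\<in>K. z' = mob B z)"
proof
  assume "G_orbit G (Fin z) = G_orbit G (Fin z')"
  then have "Fin z' \<in> G_orbit G (Fin z)"
    using mem_G_orbit by simp
  then show "\<exists>B\<in>K. z' = mob B z"
    by (auto simp: G_orbit_Fin[OF z])
next
  have sub: "G_orbit G (Fin (mob B z)) \<subseteq> G_orbit G (Fin z)" if Bz: "B \<in> K" "Im z > 0" for B z
  proof
    fix q assume "q \<in> G_orbit G (Fin (mob B z))"
    then obtain C where "C \<in> K" "q = Fin (mob C (mob B z))"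
      using Bz by (auto simp: G_orbit_Fin Im_mob_pos K_det)
    then have "q = Fin (mob (C ** B) z)" "C ** B \<in> K"
      using Bz by (simp_all add: mob_mult K_det K_mult)
    then show "q \<in> G_orbit G (Fin z)"
      using Bz by (auto simp: G_orbit_Fin)
  qed
  assume "\<exists>B\<in>K. z' = mob B z"
  then obtain B where B: "B \<in> K" "z' = mob B z"
    by blast
  then have "z = mob (adj B) z'"
    using z by (simp add: mob_adj_cancel K_det)
  then show "G_orbit G (Fin z) = G_orbit G (Fin z')"
    using sub[OF B(1) z] sub[OF K_adj[OF B(1)] z'] B(2) by auto
qed

text \<open>The points lying over the image form the union of the translates of S by
  \<open>K\<close>, which are open. No cusp is among them, so the condition on cusp neighbourhoods
  is vacuous.\<close>

lemma openin_G_orbit_image: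
  assumes S: "open S" "S \<subseteq> upper_half_plane"
  shows "openin (modular_curve_topology G) ((\<lambda>z. G_orbit G (Fin z)) ` S)"
proof -
  let ?V = "(\<lambda>z. G_orbit G (Fin z)) ` S"
  have pre: "{p \<in> Hstar. G_orbit G p \<in> ?V} = Fin ` (\<Union>B\<in>K. mob B ` S)"
  proof (intro equalityI subsetI)
    fix p assume "p \<in> {p \<in> Hstar. G_orbit G p \<in> ?V}"
    then obtain z where z: "z \<in> S" "G_orbit G p = G_orbit G (Fin z)"
      by auto
    moreover have "Im z > 0"
      using z(1) S(2) by (auto simp: upper_half_plane_def)
    ultimately have "p \<in> (\<lambda>B. Fin (mob B z)) ` K"
      using mem_G_orbit[of p] by (simp add: G_orbit_Fin)
    then show "p \<in> Fin ` (\<Union>B\<in>K. mob B ` S)"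
      using z(1) by blast
  next
    fix p assume "p \<in> Fin ` (\<Union>B\<in>K. mob B ` S)"
    then obtain B z where Bz: "B \<in> K" "z \<in> S" "p = Fin (mob B z)"
      by blast
    moreover have z: "Im z > 0"
      using Bz(2) S(2) by (auto simp: upper_half_plane_def)
    moreover have w: "Im (mob B z) > 0"
      using Bz(1) z by (simp add: Im_mob_pos K_det)
    moreover have "G_orbit G (Fin z) = G_orbit G p"
      using G_orbit_Fin_eq_iff[OF z w] Bz by blast
    ultimately show "p \<in> {p \<in> Hstar. G_orbit G p \<in> ?V}"
      by (auto simp: Hstar_def upper_half_plane_def)
  qed
  have sub: "(\<Union>B\<in>K. mob B ` S) \<subseteq> upper_half_plane"
    using S(2) by (auto simp: upper_half_plane_def Im_mob_pos K_det subset_iff)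
  have "open (\<Union>B\<in>K. mob B ` S)"
    using S by (intro open_UN ballI open_mob_image) (simp_all add: K_det)
  moreover have "{z \<in> upper_half_plane. Fin z \<in> Fin ` (\<Union>B\<in>K. mob B ` S)} = (\<Union>B\<in>K. mob B ` S)"
    using sub by (auto simp del: UN_iff)
  moreover have "Fin ` (\<Union>B\<in>K. mob B ` S) \<inter> boundary_cusps = {}"
  proof -
    have "Fin z \<notin> boundary_cusps" if "Im z > 0" for z
      using that mat_act_Infty_not_upper[of _ z] unfolding boundary_cusps_eq by fastforce
    then show ?thesis
      using sub by (auto simp: upper_half_plane_def)
  qed
  moreover have "Fin ` (\<Union>B\<in>K. mob B ` S) \<subseteq> Hstar"
    using sub unfolding Hstar_def by blast
  ultimately have "Hstar_open (Fin ` (\<Union>B\<in>K. mob B ` S))"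
    unfolding Hstar_open_def by (simp only: ball_simps simp_thms)
  moreover have "?V \<subseteq> modular_curve G"
    using S(2) unfolding modular_curve_def orbits_def G_orbit_def Hstar_def by auto
  ultimately show ?thesis
    unfolding openin_modular_curve_topology modular_curve_open_def pre openin_Hstar_topology by blast
qed

lemma continuous_map_G_orbit:
  "continuous_map (top_of_set upper_half_plane) (modular_curve_topology G) (\<lambda>z. G_orbit G (Fin z))"
proof -
  have "(\<lambda>z. G_orbit G (Fin z)) ` upper_half_plane \<subseteq> topspace (modular_curve_topology G)"
    using openin_G_orbit_image[of upper_half_plane, THEN openin_subset] open_halfspace_Im_gt[of 0]
    by (simp add: upper_half_plane_def)
  moreover have "openin (top_of_set upper_half_plane) {z \<in> upper_half_plane. G_orbit G (Fin z) \<in> U}"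
    if "openin (modular_curve_topology G) U" for U
  proof -
    have "open {z \<in> upper_half_plane. Fin z \<in> {p \<in> Hstar. G_orbit G p \<in> U}}"
      using that unfolding openin_modular_curve_topology modular_curve_open_def
        openin_Hstar_topology Hstar_open_def by blast
    moreover have "{z \<in> upper_half_plane. Fin z \<in> {p \<in> Hstar. G_orbit G p \<in> U}}
        = {z \<in> upper_half_plane. G_orbit G (Fin z) \<in> U}"
      by (auto simp: Hstar_def)
    ultimately show ?thesis
      by (intro open_subset) auto
  qed
  ultimately show ?thesis
    by (auto simp: continuous_map_def)
qed

text \<open>The copies of the edges are permuted by all of \<open>SLZ\<close>, so neither the choice
  of a point in the orbit nor the shift by \<gamma> matters, and the question becomes the one at
  \<infinity>.\<close>

lemma edge_locus_iff:
  assumes \<gamma>: "\<gamma> \<in> SLZ" and z: "Im z > 1"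
  shows "G_orbit G (Fin (mob \<gamma> z)) \<in> edge_locus G \<longleftrightarrow> 2 * Re z \<in> \<int>"
proof -
  have d: "det \<gamma> = 1"
    by (rule SLZ_det[OF \<gamma>])
  have locus: "x \<in> edge_locus G \<longleftrightarrow> (\<exists>A\<in>SLZ. \<exists>e\<in>triangle_edges. \<exists>p\<in>e. x = G_orbit G (mat_act A p))"
    for x
    by (auto simp: edge_locus_def carrier_PSL2Z)
  have act: "mat_act \<gamma> (Fin z) = Fin (mob \<gamma> z)" "mat_act (adj \<gamma>) (Fin (mob \<gamma> z)) = Fin z"
    using z d by (simp_all add: mat_act_Fin Im_mob_pos mob_adj_cancel del: mat_act.simps)
  have "G_orbit G (Fin (mob \<gamma> z)) \<in> edge_locus G \<longleftrightarrow>
      (\<exists>A\<in>SLZ. \<exists>e\<in>triangle_edges. \<exists>p\<in>e. mat_act A p = Fin z)"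
  proof
    assume "G_orbit G (Fin (mob \<gamma> z)) \<in> edge_locus G"
    then obtain A e p where A: "A \<in> SLZ" and e: "e \<in> triangle_edges" "p \<in> e"
      and "G_orbit G (Fin (mob \<gamma> z)) = G_orbit G (mat_act A p)"
      unfolding locus by blast
    then have "Fin (mob \<gamma> z) \<in> G_orbit G (mat_act A p)"
      using mem_G_orbit by metis
    then obtain B where B: "B \<in> K" "Fin (mob \<gamma> z) = mat_act B (mat_act A p)"
      unfolding G_orbit_eq by blast
    then have "Fin z = mat_act (adj \<gamma>) (mat_act (B ** A) p)"
      using mat_act_mult[OF K_det[OF B(1)] SLZ_det[OF A] triangle_edges_point[OF e]] act(2) by simp
    also have "\<dots> = mat_act (adj \<gamma> ** (B ** A)) p"
      by (rule mat_act_mult[symmetric])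
         (simp_all add: d det_mul K_det[OF B(1)] SLZ_det[OF A] triangle_edges_point[OF e])
    finally have "mat_act (adj \<gamma> ** (B ** A)) p = Fin z"
      by simp
    moreover have "adj \<gamma> ** (B ** A) \<in> SLZ"
      by (simp add: SLZ_mult SLZ_adj \<gamma> A K_SLZ[OF B(1)])
    ultimately show "\<exists>A\<in>SLZ. \<exists>e\<in>triangle_edges. \<exists>p\<in>e. mat_act A p = Fin z"
      using e by blast
  next
    assume "\<exists>A\<in>SLZ. \<exists>e\<in>triangle_edges. \<exists>p\<in>e. mat_act A p = Fin z"
    then obtain A e p where A: "A \<in> SLZ" and e: "e \<in> triangle_edges" "p \<in> e"
      and p: "mat_act A p = Fin z"
      by blast
    have "mat_act (\<gamma> ** A) p = Fin (mob \<gamma> z)"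
      using mat_act_mult[OF d SLZ_det[OF A] triangle_edges_point[OF e]] act(1) p by simp
    then show "G_orbit G (Fin (mob \<gamma> z)) \<in> edge_locus G"
      unfolding locus using SLZ_mult[OF \<gamma> A] e by metis
  qed
  then show ?thesis
    using edge_near_infinity_iff[OF z] by simp
qed

text \<open>Removing the edges removes the cusp itself, so what remains of its neighbourhood lies in
  the image of the half-plane.\<close>

lemma cusp_in_edge_locus:
  assumes "\<gamma> \<in> SLZ"
  shows "G_orbit G (mat_act \<gamma> Infty) \<in> edge_locus G"
proof -
  have "{Fin 0, Infty} \<union> Fin ` {z. Re z = 0 \<and> Im z > 0} \<in> triangle_edges"
    by (simp add: triangle_edges_def)
  moreover have "pclass \<gamma> \<in> carrier PSL2Z"
    using assms by (simp add: carrier_PSL2Z)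
  ultimately show ?thesis
    unfolding edge_locus_def by (metis (no_types, lifting) UN_iff UnI1 imageI insertI1 insertI2 psl_act_pclass)
qed

text \<open>If B identifies the two points, its conjugate by the inverse of \<gamma> maps one point
  of height above 1 to another, so it fixes \<infinity> and is a translation up to sign.\<close>

lemma G_orbit_near_cusp_eq_iff:
  assumes \<gamma>: "\<gamma> \<in> SLZ" and z: "Im z > 1" and z': "Im z' > 1"
  shows "G_orbit G (Fin (mob \<gamma> z)) = G_orbit G (Fin (mob \<gamma> z')) \<longleftrightarrow>
    (\<exists>n :: int. \<gamma> ** transl n ** adj \<gamma> \<in> K \<and> z' = z + of_int n)"
proof -
  have d: "det \<gamma> = 1"
    by (rule SLZ_det[OF \<gamma>])
  have pos: "Im (mob \<gamma> z) > 0" "Im (mob \<gamma> z') > 0"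
    using z z' by (simp_all add: Im_mob_pos d)
  have "(\<exists>B\<in>K. mob \<gamma> z' = mob B (mob \<gamma> z)) \<longleftrightarrow> (\<exists>n :: int. \<gamma> ** transl n ** adj \<gamma> \<in> K \<and> z' = z + of_int n)"
  proof
    assume "\<exists>B\<in>K. mob \<gamma> z' = mob B (mob \<gamma> z)"
    then obtain B where B: "B \<in> K" "mob \<gamma> z' = mob B (mob \<gamma> z)"
      by blast
    define C where "C = adj \<gamma> ** (B ** \<gamma>)"
    have "mob C z = mob (adj \<gamma>) (mob B (mob \<gamma> z))"
      using z by (simp add: C_def mob_mult d det_mul K_det[OF B(1)])
    also have "\<dots> = z'"
      using z' by (simp add: mob_adj_cancel d flip: B(2))
    finally have Cz: "mob C z = z'" .
    have C: "C \<in> SLZ"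
      by (simp add: C_def SLZ_mult SLZ_adj \<gamma> K_SLZ[OF B(1)])
    have "C$2$1 = 0"
      using SLZ_lower_left_zero[OF C z] Cz z' by simp
    then obtain n :: int where n: "C = transl n \<or> C = - transl n"
      using SLZ_upper_triangular[OF C] by blast
    have "\<gamma> ** C ** adj \<gamma> = B"
      by (simp add: C_def d mul_adj flip: matrix_mul_assoc)
    then have "\<gamma> ** transl n ** adj \<gamma> \<in> K"
      using n B(1) K_minus[OF B(1)] by (metis matmul_minus minus_minus)
    moreover have "z' = z + of_int n"
      using n Cz by auto
    ultimately show "\<exists>n :: int. \<gamma> ** transl n ** adj \<gamma> \<in> K \<and> z' = z + of_int n"
      by (intro exI[of _ n] conjI)
  next
    assume "\<exists>n :: int. \<gamma> ** transl n ** adj \<gamma> \<in> K \<and> z' = z + of_int n"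
    then obtain n :: int where n: "\<gamma> ** transl n ** adj \<gamma> \<in> K" "z' = z + of_int n"
      by blast
    have "mob (\<gamma> ** transl n ** adj \<gamma>) (mob \<gamma> z) = mob (\<gamma> ** transl n) (mob (adj \<gamma>) (mob \<gamma> z))"
      using pos by (simp add: mob_mult d)
    also have "\<dots> = mob \<gamma> z'"
      using z n(2) by (simp add: mob_adj_cancel mob_mult d)
    finally show "\<exists>B\<in>K. mob \<gamma> z' = mob B (mob \<gamma> z)"
      using n(1) by metis
  qed
  then show ?thesis
    using G_orbit_Fin_eq_iff[OF pos] by simp
qed

text \<open>These n form the preimage of \<open>K\<close> under a homomorphism from the integers,
  namely \<open>transl\<close> followed by conjugation with \<gamma>. The value w = 0 means that
  \<open>K\<close> has no parabolic element at this cusp.\<close>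

lemma width_generator:
  assumes \<gamma>: "\<gamma> \<in> SLZ"
  obtains w :: int where "w \<ge> 0" "\<And>n. \<gamma> ** transl (of_int n) ** adj \<gamma> \<in> K \<longleftrightarrow> w dvd n"
proof -
  have d: "det \<gamma> = 1"
    by (rule SLZ_det[OF \<gamma>])
  let ?W = "{n :: int. \<gamma> ** transl (of_int n) ** adj \<gamma> \<in> K}"
  have "0 \<in> ?W"
    by (simp add: mul_adj d K_one)
  moreover have "m - n \<in> ?W" if "m \<in> ?W" "n \<in> ?W" for m n
  proof -
    have "(\<gamma> ** transl m ** adj \<gamma>) ** adj (\<gamma> ** transl n ** adj \<gamma>) \<in> K"
      using that by (simp add: K_mult K_adj)
    also have "(\<gamma> ** transl m ** adj \<gamma>) ** adj (\<gamma> ** transl n ** adj \<gamma>)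
        = \<gamma> ** (transl m ** transl (- n)) ** adj \<gamma>"
      by (simp add: adj_mul d flip: matrix_mul_assoc)
    finally show ?thesis
      by (simp add: transl_add)
  qed
  ultimately show thesis
    using int_subgroup_generator[of ?W] that by auto
qed

text \<open>The projection is open and continuous, so the image of each half-strip is open and
  connected. Two images are equal or disjoint, and together they fill the neighbourhood without the
  edges; hence they are its components.\<close>

lemma sectors_eq:
  assumes \<gamma>: "\<gamma> \<in> SLZ" and Y: "Y \<ge> 1"
    and hb: "horoball r (mat_act \<gamma> Infty) = mob \<gamma> ` upper_part Y"
    and width: "\<And>n. \<gamma> ** transl (of_int n) ** adj \<gamma> \<in> K \<longleftrightarrow> w dvd n"
  defines "sec \<equiv> \<lambda>k. (\<lambda>z. G_orbit G (Fin (mob \<gamma> z))) ` strip Y k"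
  shows "sectors G (mat_act \<gamma> Infty) r = range sec"
    and "sec j = sec k \<longleftrightarrow> 2 * w dvd k - j"
proof -
  let ?s = "mat_act \<gamma> Infty"
  let ?\<pi> = "\<lambda>z. G_orbit G (Fin (mob \<gamma> z))"
  let ?X = "modular_curve_topology G"
  let ?A = "G_orbit G ` cusp_nhd r ?s - edge_locus G"
  have d: "det \<gamma> = 1"
    by (rule SLZ_det[OF \<gamma>])
  have big: "Im z > 1" if "z \<in> strip Y k" for z k
    using that Y by (simp add: strip_def)
  have \<pi>_eq_iff: "?\<pi> z = ?\<pi> z' \<longleftrightarrow> (\<exists>n. w dvd n \<and> z' = z + of_int n)"
    if "z \<in> strip Y j" "z' \<in> strip Y k" for z z' j k
    using G_orbit_near_cusp_eq_iff[OF \<gamma> big[OF that(1)] big[OF that(2)]] width by simp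
  have meet: "2 * w dvd k - j" if zz': "z \<in> strip Y j" "z' \<in> strip Y k" "?\<pi> z = ?\<pi> z'" for z z' j k
  proof -
    obtain n where n: "w dvd n" "z' = z + of_int n"
      using \<pi>_eq_iff[OF zz'(1,2)] zz'(3) by blast
    then have "k = j + 2 * n"
      using zz'(1,2) strip_disjoint[of z Y j "k - 2 * n"] by (simp add: strip_translate)
    then show ?thesis
      using n(1) two_times_dvd_iff by blast
  qed
  have sec_sub: "sec j \<subseteq> sec k" if jk: "2 * w dvd k - j" for j k
  proof
    fix x assume "x \<in> sec j"
    then obtain z where z: "z \<in> strip Y j" "x = ?\<pi> z"
      by (auto simp: sec_def)
    obtain n where n: "w dvd n" "k = j + 2 * n"
      using jk two_times_dvd_iff by blast
    then have z': "z + of_int n \<in> strip Y k"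
      using z(1) by (simp add: strip_translate)
    then have "?\<pi> z = ?\<pi> (z + of_int n)"
      using \<pi>_eq_iff[OF z(1) z'] n(1) by blast
    then show "x \<in> sec k"
      using z(2) z' unfolding sec_def by blast
  qed
  have sec_eq_if: "sec j = sec k" if "2 * w dvd k - j" for j k
    using sec_sub[OF that] sec_sub[of j k] that by (simp add: dvd_diff_commute subset_antisym)
  have sec_meet: "sec j = sec k" if x: "x \<in> sec j" "x \<in> sec k" for x j k
  proof -
    obtain z z' where "z \<in> strip Y j" "z' \<in> strip Y k" "?\<pi> z = ?\<pi> z'"
      using x by (auto simp: sec_def)
    then show ?thesis
      using sec_eq_if meet by blast
  qed
  have sec_ne: "sec k \<noteq> {}" for k
    using strip_nonempty by (simp add: sec_def)
  show "sec j = sec k \<longleftrightarrow> 2 * w dvd k - j"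
  proof
    assume eq: "sec j = sec k"
    obtain x where x: "x \<in> sec j"
      using sec_ne by blast
    moreover from x eq have "x \<in> sec k"
      by simp
    ultimately obtain z z' where "z \<in> strip Y j" "z' \<in> strip Y k" "?\<pi> z = ?\<pi> z'"
      by (auto simp: sec_def)
    then show "2 * w dvd k - j"
      by (rule meet)
  qed (rule sec_eq_if)
  have strip_sub: "strip Y k \<subseteq> {z. Im z > 0}" for k
    using big by fastforce
  have mob_sub: "mob \<gamma> ` strip Y k \<subseteq> upper_half_plane" for k
    using strip_sub[of k] d by (auto simp: upper_half_plane_def Im_mob_pos)
  have sec_image: "sec k = (\<lambda>z. G_orbit G (Fin z)) ` (mob \<gamma> ` strip Y k)" for k
    by (simp add: sec_def image_image)
  have op: "openin ?X (sec k)" for k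
    unfolding sec_image using strip_sub[of k]
    by (intro openin_G_orbit_image open_mob_image mob_sub d open_strip)
       (simp add: upper_half_plane_def)
  have "connected (mob \<gamma> ` strip Y k)" for k
    using continuous_on_subset[OF continuous_on_mob[OF d] strip_sub] connected_strip
    by (rule connected_continuous_image)
  then have conn: "connectedin ?X (sec k)" for k
    unfolding sec_image using mob_sub
    by (intro connectedin_continuous_map_image[OF continuous_map_G_orbit])
       (simp add: connectedin_subtopology)
  have A_eq: "?A = \<Union>(range sec)"
  proof -
    have "G_orbit G ` cusp_nhd r ?s = insert (G_orbit G ?s) (?\<pi> ` upper_part Y)"
      unfolding cusp_nhd_def hb by (simp only: image_insert image_image)
    moreover have "?\<pi> z \<in> edge_locus G \<longleftrightarrow> 2 * Re z \<in> \<int>" if "z \<in> upper_part Y" for z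
      using edge_locus_iff[OF \<gamma>, of z] that Y by (simp add: upper_part_def)
    ultimately have "?A = ?\<pi> ` {z \<in> upper_part Y. 2 * Re z \<notin> \<int>}"
      using cusp_in_edge_locus[OF \<gamma>] by auto
    then show ?thesis
      unfolding Union_strip[symmetric] by (simp add: sec_def image_UN)
  qed
  have sub_A: "sec k \<subseteq> ?A" for k
    unfolding A_eq by blast
  show "sectors G ?s r = range sec"
    unfolding sectors_def
  proof (rule connected_components_of_open_partition)
    fix U assume "U \<in> range sec"
    then obtain k where k: "U = sec k"
      by blast
    show "openin (subtopology ?X ?A) U"
      unfolding k openin_subtopology using op[of k] sub_A[of k] by blast
    show "connectedin (subtopology ?X ?A) U"
      unfolding k connectedin_subtopology using conn sub_A by blast
    show "U \<noteq> {}"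
      unfolding k by (rule sec_ne)
  next
    show "pairwise disjnt (range sec)"
      unfolding pairwise_def disjnt_def using sec_meet by blast
    have "\<Union>(range sec) \<subseteq> topspace ?X"
      using op openin_subset by blast
    then show "\<Union>(range sec) = topspace (subtopology ?X ?A)"
      unfolding A_eq topspace_subtopology by blast
  qed
qed

section \<open>Widths of cusps\<close>

lemma eventually_card_sectors:
  assumes \<gamma>: "\<gamma> \<in> SLZ" and "w \<ge> 0"
    and width: "\<And>n. \<gamma> ** transl (of_int n) ** adj \<gamma> \<in> K \<longleftrightarrow> w dvd n"
  shows "\<forall>\<^sub>F r in at_right 0.
    ecard (sectors G (mat_act \<gamma> Infty) r) = (if w = 0 then \<infinity> else enat (nat (2 * w)))"
  using eventually_horoball_eq[OF \<gamma>]
proof eventually_elim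
  case (elim r)
  then obtain Y where "Y \<ge> 1" "horoball r (mat_act \<gamma> Infty) = mob \<gamma> ` upper_part Y"
    by blast
  note sec = sectors_eq[OF \<gamma> this width]
  show ?case
    unfolding sec(1) using ecard_range_periodic[OF sec(2)] \<open>w \<ge> 0\<close> by simp
qed

text \<open>The points of the orbit are B \<gamma> \<infinity> with B in \<open>K\<close>, and
  conjugation by B preserves \<open>K\<close>, so the same w serves all of them.\<close>

lemma cusp_width_eq:
  assumes \<gamma>: "\<gamma> \<in> SLZ" and "w \<ge> 0"
    and width: "\<And>n. \<gamma> ** transl (of_int n) ** adj \<gamma> \<in> K \<longleftrightarrow> w dvd n"
  shows "cusp_width G (G_orbit G (mat_act \<gamma> Infty)) = (if w = 0 then \<infinity> else enat (nat (2 * w)))"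
    (is "_ = ?N")
proof -
  have all: "\<forall>\<^sub>F r in at_right 0. ecard (sectors G s r) = ?N"
    if s_in: "s \<in> G_orbit G (mat_act \<gamma> Infty)" for s
  proof -
    obtain B where B: "B \<in> K" "s = mat_act B (mat_act \<gamma> Infty)"
      using s_in unfolding G_orbit_eq by blast
    have s: "s = mat_act (B ** \<gamma>) Infty"
      unfolding B(2) by (rule mat_act_mult_Infty[OF K_det[OF B(1)] SLZ_det[OF \<gamma>], symmetric])
    have dB: "det B = 1"
      by (rule K_det[OF B(1)])
    have "(B ** \<gamma>) ** transl (of_int n) ** adj (B ** \<gamma>) \<in> K \<longleftrightarrow> w dvd n" for n
    proof -
      let ?T = "\<gamma> ** transl (of_int n) ** adj \<gamma>"
      have eq: "(B ** \<gamma>) ** transl (of_int n) ** adj (B ** \<gamma>) = B ** ?T ** adj B"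
        by (simp add: adj_mul matrix_mul_assoc)
      have "adj B ** (B ** ?T ** adj B) ** B = ?T"
        by (simp add: dB adj_mul_self flip: matrix_mul_assoc)
      then have "B ** ?T ** adj B \<in> K \<longleftrightarrow> ?T \<in> K"
        using B(1) by (metis K_adj K_mult)
      then show ?thesis
        by (simp only: eq width)
    qed
    then show ?thesis
      unfolding s by (intro eventually_card_sectors SLZ_mult K_SLZ B(1) \<gamma> \<open>w \<ge> 0\<close>)
  qed
  show ?thesis
    unfolding cusp_width_def
  proof (rule the_equality)
    show "\<forall>s\<in>G_orbit G (mat_act \<gamma> Infty). \<forall>\<^sub>F r in at_right 0. ecard (sectors G s r) = ?N"
      using all by blast
    fix n assume "\<forall>s\<in>G_orbit G (mat_act \<gamma> Infty). \<forall>\<^sub>F r in at_right 0. ecard (sectors G s r) = n"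
    then have "\<forall>\<^sub>F r in at_right 0. ecard (sectors G (mat_act \<gamma> Infty) r) = n"
      by (rule bspec) (rule mem_G_orbit)
    \<comment> \<open>Two eventual values agree because the filter \<open>at_right 0\<close> is
      nontrivial.\<close>
    with all[OF mem_G_orbit] have "\<forall>\<^sub>F r in at_right (0::real). n = ?N"
      by eventually_elim (erule trans[OF sym])
    then show "n = ?N"
      by (simp add: eventually_const)
  qed
qed

text \<open>A finite width forces w > 0, and the width 2 w determines w, so a common width gives a
  common generator at all cusps.\<close>

lemma equal_widths:
  assumes fin: "\<forall>x\<in>cusps G. cusp_width G x \<noteq> \<infinity>"
    and eq: "\<forall>x\<in>cusps G. \<forall>y\<in>cusps G. cusp_width G x = cusp_width G y"
  obtains w :: int where "w > 0"
    "\<And>\<gamma> n. \<gamma> \<in> SLZ \<Longrightarrow> \<gamma> ** transl (of_int n) ** adj \<gamma> \<in> K \<longleftrightarrow> w dvd n"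
proof -
  have cusp: "G_orbit G (mat_act \<gamma> Infty) \<in> cusps G" if "\<gamma> \<in> SLZ" for \<gamma>
    using that unfolding cusps_def orbits_def G_orbit_def boundary_cusps_eq by blast
  obtain w where w: "w \<ge> 0"
    "\<And>n. mat 1 ** transl (of_int n) ** adj (mat 1) \<in> K \<longleftrightarrow> w dvd n"
    using width_generator[OF SLZ_one] by blast
  note cw = cusp_width_eq[OF SLZ_one w]
  have "w \<noteq> 0"
    using fin cusp[OF SLZ_one] cw by auto
  show thesis
  proof
    show "w > 0"
      using w(1) \<open>w \<noteq> 0\<close> by simp
    fix \<gamma> n assume \<gamma>: "\<gamma> \<in> SLZ"
    obtain w' where w': "w' \<ge> 0" "\<And>n. \<gamma> ** transl (of_int n) ** adj \<gamma> \<in> K \<longleftrightarrow> w' dvd n"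
      using width_generator[OF \<gamma>] by blast
    have "cusp_width G (G_orbit G (mat_act \<gamma> Infty)) = cusp_width G (G_orbit G (mat_act (mat 1) Infty))"
      using eq cusp[OF \<gamma>] cusp[OF SLZ_one] by blast
    then have "w' = w"
      unfolding cw cusp_width_eq[OF \<gamma> w'] using w(1) w'(1) \<open>w \<noteq> 0\<close> by (auto split: if_splits)
    then show "\<gamma> ** transl (of_int n) ** adj \<gamma> \<in> K \<longleftrightarrow> w dvd n"
      using w'(2) by simp
  qed
qed

end

theorem proposition4p4:
  fixes G :: "(real^2^2) set set"
  assumes "subgroup G PSL2Z"
    and "\<forall>x\<in>cusps G. cusp_width G x \<noteq> \<infinity>"
    and "\<forall>x\<in>cusps G. \<forall>y\<in>cusps G. cusp_width G x = cusp_width G y"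
  shows "(PSL2Z\<lparr>carrier := normalizer PSL2Z G\<rparr>) Mod G
       = (PSL2R\<lparr>carrier := normalizer PSL2R G\<rparr>) Mod G"
proof -
  interpret modular_subgroup G
    by (rule modular_subgroup.intro) (rule assms(1))
  obtain w :: int where "w > 0"
    "\<And>\<gamma> n. \<gamma> \<in> SLZ \<Longrightarrow> \<gamma> ** transl (of_int n) ** adj \<gamma> \<in> K \<longleftrightarrow> w dvd n"
    using equal_widths[OF assms(2,3)] by blast
  then have "Nor \<inter> SLZ = Nor"
    using Nor_subset_SLZ by blast
  then have "normalizer PSL2Z G = normalizer PSL2R G"
    by (simp add: normalizer_PSL2Z normalizer_PSL2R)
  \<comment> \<open>Product and unit are common to both groups, so equal carriers give equal
    quotients.\<close>
  moreover have "PSL2Z\<lparr>carrier := X\<rparr> = PSL2R\<lparr>carrier := X\<rparr>" for X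
    by (subst PSL2Z_eq) simp
  ultimately show ?thesis
    by simp
qed

end
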